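(* Let $d\in\mathbb{N}$, $d\geq 1$, and let $\mathcal{A}$ be the real unital algebra of functions on $\mathbb{R}^d\setminus\{0\}$ generated by the (restrictions of) polynomials in $\mathbb{R}[x_1,\dots,x_d]$ and the functions $f_{kl}(x)=x_kx_l\,(x_1^2+\dots+x_d^2)^{-1}$, $k,l=1,\dots,d$. A linear functional $L$ on $\mathbb{R}[x_1,\dots,x_d]$ is a moment functional if and only if it has an extension to a positive linear functional $\mathcal{L}$ on the larger algebra $\mathcal{A}$.
   Context: The polynomial algebra $\mathbb{R}[x_1,\dots,x_d]$ is regarded as a subalgebra of $\mathcal{A}$ by restricting polynomial functions to $\mathbb{R}^d\setminus\{0\}$ (this restriction is injective). A linear functional $L:\mathbb{R}[x_1,\dots,x_d]\to\mathbb{R}$ is a moment functional if there is a positive Borel measure $\mu$ on $\mathbb{R}^d$ such that every polynomial $p$ is $\mu$-integrable and $L(p)=\int_{\mathbb{R}^d}p(x)\,d\mu(x)$ for all $p\in\mathbb{R}[x_1,\dots,x_d]$. A linear functional $\mathcal{L}:\mathcal{A}\to\mathbb{R}$ is positive if $\mathcal{L}(a^2)\ge0$ for all $a\in\mathcal{A}$. *)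

theory Defs
  imports "HOL-Analysis.Analysis" "HOL-Library.Poly_Mapping"
begin

text \<open>
  The polynomial ring \<open>\<real>[x\<^sub>1, \<dots>, x\<^sub>d]\<close>, with variables indexed by a finite type \<open>'n\<close> and
  \<open>d = CARD('n) \<ge> 1\<close>: a polynomial is a finitely supported map from exponent vectors to
  coefficients.
\<close>

type_synonym 'n polynomial = "('n \<Rightarrow>\<^sub>0 nat) \<Rightarrow>\<^sub>0 real"

definition poly_eval :: "'n::finite polynomial \<Rightarrow> real ^ 'n \<Rightarrow> real" where
  "poly_eval p x =
     (\<Sum>m\<in>Poly_Mapping.keys p. Poly_Mapping.lookup p m * (\<Prod>i\<in>UNIV. (x $ i) ^ Poly_Mapping.lookup m i))"

definition linear_functional :: "('n::finite polynomial \<Rightarrow> real) \<Rightarrow> bool" where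
  "linear_functional L \<longleftrightarrow>
     (\<forall>p q. L (p + q) = L p + L q) \<and>
     (\<forall>c p. L (Poly_Mapping.map ((*) c) p) = c * L p)"

definition moment_functional :: "('n::finite polynomial \<Rightarrow> real) \<Rightarrow> bool" where
  "moment_functional L \<longleftrightarrow>
     (\<exists>M :: (real ^ 'n) measure. sets M = sets borel \<and>
        (\<forall>p. integrable M (poly_eval p) \<and> L p = (\<integral>x. poly_eval p x \<partial>M)))"

text \<open>
  A function on a set \<open>X\<close> is represented by its extensional version (\<open>undefined\<close> outside \<open>X\<close>), so
  that equality of representatives is equality on \<open>X\<close>.
\<close>

inductive_set generated_algebra :: "'a set \<Rightarrow> ('a \<Rightarrow> real) set \<Rightarrow> ('a \<Rightarrow> real) set"
  for X :: "'a set" and G :: "('a \<Rightarrow> real) set" where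
  gen: "g \<in> G \<Longrightarrow> restrict g X \<in> generated_algebra X G"
| const: "(\<lambda>x\<in>X. c) \<in> generated_algebra X G"
| add: "f \<in> generated_algebra X G \<Longrightarrow> g \<in> generated_algebra X G \<Longrightarrow>
    (\<lambda>x\<in>X. f x + g x) \<in> generated_algebra X G"
| mult: "f \<in> generated_algebra X G \<Longrightarrow> g \<in> generated_algebra X G \<Longrightarrow>
    (\<lambda>x\<in>X. f x * g x) \<in> generated_algebra X G"

definition linear_functional_on :: "'a set \<Rightarrow> ('a \<Rightarrow> real) set \<Rightarrow> (('a \<Rightarrow> real) \<Rightarrow> real) \<Rightarrow> bool" where
  "linear_functional_on X A F \<longleftrightarrow>
     (\<forall>f\<in>A. \<forall>g\<in>A. F (\<lambda>x\<in>X. f x + g x) = F f + F g) \<and>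
     (\<forall>c. \<forall>f\<in>A. F (\<lambda>x\<in>X. c * f x) = c * F f)"

definition positive_functional_on :: "'a set \<Rightarrow> ('a \<Rightarrow> real) set \<Rightarrow> (('a \<Rightarrow> real) \<Rightarrow> real) \<Rightarrow> bool" where
  "positive_functional_on X A F \<longleftrightarrow> (\<forall>f\<in>A. 0 \<le> F (\<lambda>x\<in>X. (f x)\<^sup>2))"

definition punctured_space :: "(real ^ 'n::finite) set" where
  "punctured_space = UNIV - {0}"

definition sphere_fun :: "'n \<Rightarrow> 'n \<Rightarrow> real ^ 'n::finite \<Rightarrow> real" where
  "sphere_fun k l x = x $ k * x $ l * inverse (\<Sum>i\<in>UNIV. (x $ i)\<^sup>2)"

definition extended_algebra :: "(real ^ 'n::finite \<Rightarrow> real) set" where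
  "extended_algebra =
     generated_algebra punctured_space (range poly_eval \<union> {sphere_fun k l | k l. True})"

end

theory Submission
  imports Defs "HOL-Probability.Probability" "HOL-Computational_Algebra.Polynomial"
begin

text \<open>
  If \<open>\<mu>\<close> represents \<open>L\<close>, integrate \<open>f \<in> \<A>\<close> against \<open>\<mu>\<close> after extending \<open>f\<close> to the origin by its limit
  along a fixed ray; this handles a possible atom of \<open>\<mu>\<close> at \<open>0\<close>.

  Conversely, write \<open>x = r s\<close> with \<open>r\<close> real and \<open>s\<close> on the unit sphere. Then \<open>\<A>\<close> consists of the
  polynomials in \<open>(r, s)\<close> that are even under \<open>(r, s) \<mapsto> (-r, -s)\<close>, and composing the given functional with
  the even part gives a functional on all polynomials in \<open>(r, s)\<close>. It is still positive: an odd \<open>g\<close>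
  satisfies \<open>g\<^sup>2 = \<Sum>\<^sub>k (g s\<^sub>k)\<^sup>2\<close> with \<open>g s\<^sub>k\<close> even. If a polynomial \<open>p\<close> is nonnegative on \<open>\<real>\<^sup>d\<close>, replace
  \<open>p(r s)\<close> by its Bernstein approximation in \<open>s \<in> [-1,1]\<^sup>d\<close>, a sum of terms
  \<open>p(r s\<^sub>j) \<Prod>\<^sub>k (1 + s\<^sub>k)\<^bsup>a\<^esup> (1 - s\<^sub>k)\<^bsup>b\<^esup>\<close>. The univariate polynomial \<open>p(r s\<^sub>j)\<close> is a sum of squares, and so is
  \<open>1 \<plusminus> s\<^sub>k\<close> on the sphere, so the functional is nonnegative on the approximations and, in the limit,
  \<open>L p \<ge> 0\<close>.

  It remains to prove Haviland's theorem. A variational argument approximates \<open>L\<close> by finitely supported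
  probability measures. A space-filling curve lifts these to the real line, where Helly's selection
  theorem yields a weak limit, and boundedness of the second moments of \<open>p\<close> shows that no mass of \<open>p\<close>
  escapes.
\<close>

section \<open>Nonnegative univariate polynomials and Bernstein approximation\<close>

text \<open>A nonconstant polynomial tends to infinity in absolute value, so \<open>p\<close>
  exceeds its value at 0 outside a compact interval, and the minimum over that interval is
  global.\<close>

lemma real_poly_attains_min:
  fixes p :: "real poly"
  assumes nonneg: "\<And>x. 0 \<le> poly p x" and deg: "degree p > 0"
  obtains a where "\<And>x. poly p a \<le> poly p x"
proof -
  have "filterlim (poly p) at_infinity at_infinity"
    using deg by (rule filterlim_poly_at_infinity)
  then have "eventually (\<lambda>x. norm (poly p x) \<ge> poly p 0 + 1) at_infinity"
    unfolding filterlim_at_infinity[OF order.refl] using nonneg[of 0]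
    by (elim allE[of _ "poly p 0 + 1"]) auto
  then obtain B where B: "\<And>x. norm x \<ge> B \<Longrightarrow> norm (poly p x) \<ge> poly p 0 + 1"
    unfolding eventually_at_infinity by blast
  define C where "C = max B 0"
  obtain a where a: "a \<in> {-C..C}" "\<And>x. x \<in> {-C..C} \<Longrightarrow> poly p a \<le> poly p x"
    using continuous_attains_inf[of "{-C..C}" "poly p"] continuous_on_poly[OF continuous_on_id]
    by (force simp: C_def)
  have "poly p a \<le> poly p x" for x
  proof (cases "x \<in> {-C..C}")
    case False
    then have "norm x \<ge> B" by (auto simp: C_def)
    from B[OF this] nonneg[of x] have "poly p x \<ge> poly p 0 + 1" by simp
    moreover have "poly p a \<le> poly p 0" by (rule a(2)) (simp add: C_def)
    ultimately show ?thesis by simp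
  qed (use a in auto)
  then show ?thesis by (rule that)
qed

text \<open>The minimiser \<open>a\<close> is a root of \<open>p - [:m:]\<close> and of its
  derivative, hence a double root. The quotient \<open>q\<close> is nonnegative away from
  \<open>a\<close> by division and at \<open>a\<close> by continuity.\<close>

lemma nonneg_poly_decompose:
  fixes p :: "real poly"
  assumes nonneg: "\<And>x. 0 \<le> poly p x" and deg: "degree p > 0"
  obtains m a q where "m \<ge> 0" "p = [:m:] + [:-a, 1:]\<^sup>2 * q" "\<And>x. 0 \<le> poly q x" "degree q < degree p"
proof -
  obtain a where a: "\<And>x. poly p a \<le> poly p x"
    using real_poly_attains_min[OF assms] by blast
  define m where "m = poly p a"
  have "poly (p - [:m:]) a = 0" by (simp add: m_def)
  then obtain r where r: "p - [:m:] = [:-a, 1:] * r"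
    by (metis poly_eq_0_iff_dvd dvdE)
  have "poly (pderiv p) a = 0"
    by (rule DERIV_local_min[of "poly p" _ a 1]) (auto intro: a poly_DERIV)
  moreover have "pderiv p = pderiv ([:-a, 1:] * r)" unfolding r[symmetric] by (simp add: pderiv_diff pderiv_pCons)
  ultimately have "poly r a = 0"
    by (simp only: pderiv_mult) (simp add: pderiv_pCons)
  then obtain q where q: "r = [:-a, 1:] * q"
    by (metis poly_eq_0_iff_dvd dvdE)
  have p: "p = [:m:] + [:-a, 1:]\<^sup>2 * q"
    using r unfolding q power2_eq_square by (simp only: mult.assoc diff_eq_eq add.commute)
  have off: "0 \<le> poly q x" if "x \<noteq> a" for x
  proof -
    have "0 \<le> poly p x - m" using a[of x] by (simp add: m_def)
    also have "\<dots> = (x - a)\<^sup>2 * poly q x" by (subst p) (simp add: power2_eq_square algebra_simps)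
    finally show ?thesis using that by (simp add: zero_le_mult_iff)
  qed
  have "0 \<le> poly q a"
  proof (rule tendsto_lowerbound)
    show "(poly q \<longlongrightarrow> poly q a) (at a)" using poly_isCont[of a q] by (simp add: isCont_def)
    show "\<forall>\<^sub>F x in at a. 0 \<le> poly q x" using off by (auto simp: eventually_at_filter)
  qed simp
  with off have qn: "0 \<le> poly q x" for x by (cases "x = a") auto
  have "degree q < degree p"
  proof (cases "q = 0")
    case False
    have "degree ([:-a, 1:]\<^sup>2 * q) = 2 + degree q"
      using False by (subst degree_mult_eq) (auto simp: degree_power_eq)
    moreover have "degree p = degree ([:-a, 1:]\<^sup>2 * q)"
      using calculation by (subst p, subst degree_add_eq_right) auto
    ultimately show ?thesis by simp
  qed (use deg in simp)
  moreover have "m \<ge> 0" using nonneg by (simp add: m_def)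
  ultimately show ?thesis using that p qn by blast
qed

text \<open>Takes the place of a representation by sums of squares. In this form the squared linear
  factor can later be absorbed into a test square.\<close>

lemma nonneg_poly_induct [consumes 1, case_names const step]:
  fixes p :: "real poly"
  assumes "\<And>x. 0 \<le> poly p x"
    and const: "\<And>c. 0 \<le> c \<Longrightarrow> P [:c:]"
    and step: "\<And>m a q. 0 \<le> m \<Longrightarrow> P q \<Longrightarrow> P ([:m:] + [:-a, 1:]\<^sup>2 * q)"
  shows "P p"
  using assms(1)
proof (induction "degree p" arbitrary: p rule: less_induct)
  case less
  show ?case
  proof (cases "degree p = 0")
    case True
    then obtain c where "p = [:c:]" by (rule degree_eq_zeroE)
    then show ?thesis using less.prems const by auto
  next
    case False
    then obtain m a q where q: "m \<ge> 0" "p = [:m:] + [:-a, 1:]\<^sup>2 * q" "\<And>x. 0 \<le> poly q x" "degree q < degree p"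
      using nonneg_poly_decompose[OF less.prems] by blast
    then have "P q" using less.hyps by blast
    then show ?thesis unfolding q(2) using q(1) step by blast
  qed
qed

section \<open>Bernstein polynomials on the interval [-1,1]\<close>

definition bernstein_node :: "nat \<Rightarrow> nat \<Rightarrow> real" where
  "bernstein_node n j = 2 * real j / real n - 1"

text \<open>The classical Bernstein basis polynomial in the variable \<open>(1 + s) / 2\<close>.
  Positivity on the sphere will be proved for the factors \<open>1 + s\<close> and
  \<open>1 - s\<close> separately.\<close>

definition bernstein_weight :: "nat \<Rightarrow> nat \<Rightarrow> real \<Rightarrow> real" where
  "bernstein_weight n j s = real (n choose j) * ((1 + s) / 2) ^ j * ((1 - s) / 2) ^ (n - j)"

text \<open>
  The Bernstein approximation on \<open>[-1,1]\<close> of \<open>s ^ m\<close>. The recursion expresses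
  \<open>bernstein_node n j * b = s * b + (1 - s\<^sup>2) / n * b'\<close> for \<open>b = bernstein_weight n j\<close>; it makes the
  convergence of the coefficients evident.
\<close>

fun bernstein_monom :: "nat \<Rightarrow> nat \<Rightarrow> real poly" where
  "bernstein_monom n 0 = 1"
| "bernstein_monom n (Suc m) = pCons 0 (bernstein_monom n m) +
     smult (1 / real n) (pderiv (bernstein_monom n m) - pCons 0 (pCons 0 (pderiv (bernstein_monom n m))))"

text \<open>The first-order differential equation of the Bernstein basis. Since
  \<open>1 - s\<^sup>2\<close> equals \<open>4 * u * v\<close>, it restores the powers that
  differentiation lowers.\<close>

lemma bernstein_weight_deriv:
  assumes "j \<le> n"
  obtains d where "(bernstein_weight n j has_real_derivative d) (at s)"
    "(1 - s\<^sup>2) * d = (2 * real j - real n - real n * s) * bernstein_weight n j s"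
proof -
  define u v where "u = (1 + s) / 2" and "v = (1 - s) / 2"
  define d where "d = real (n choose j) *
     (real j * u ^ (j - 1) / 2 * v ^ (n - j) - real (n - j) * v ^ (n - j - 1) / 2 * u ^ j)"
  have "(bernstein_weight n j has_real_derivative d) (at s)"
    unfolding bernstein_weight_def[abs_def] d_def u_def v_def
    by (auto intro!: derivative_eq_intros simp: algebra_simps)
  moreover have "(1 - s\<^sup>2) * d = (2 * real j - real n - real n * s) * bernstein_weight n j s"
  proof -
    \<comment> \<open>For \<open>j = 0\<close> the truncated exponent is harmless because the factor
      \<open>real j\<close> vanishes; likewise for \<open>n - j = 0\<close> in the next
      line.\<close>
    have 1: "real j * u ^ (j - 1) * u = real j * u ^ j" by (cases j) auto
    have 2: "real (n - j) * v ^ (n - j - 1) * v = real (n - j) * v ^ (n - j)" by (cases "n - j") auto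
    have s: "1 - s\<^sup>2 = 4 * u * v" by (simp add: u_def v_def power2_eq_square field_simps)
    have "(1 - s\<^sup>2) * d = real (n choose j) *
       (2 * v * (real j * u ^ (j - 1) * u) * v ^ (n - j) - 2 * u * (real (n - j) * v ^ (n - j - 1) * v) * u ^ j)"
      unfolding s d_def by (simp add: algebra_simps)
    also have "\<dots> = (2 * v * real j - 2 * u * (real n - real j)) * (real (n choose j) * u ^ j * v ^ (n - j))"
      unfolding 1 2 using assms by (simp add: algebra_simps of_nat_diff)
    also have "2 * v * real j - 2 * u * (real n - real j) = 2 * real j - real n - real n * s"
      by (simp add: u_def v_def field_simps)
    finally show ?thesis by (simp add: bernstein_weight_def u_def v_def)
  qed
  ultimately show ?thesis by (rule that)
qed

text \<open>The case \<open>m = 0\<close> is the binomial theorem. In the step the induction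
  hypothesis is differentiated, and by the differential equation the terms of the recursion combine
  to one more factor \<open>bernstein_node n j\<close>.\<close>

lemma poly_bernstein_monom:
  assumes "n > 0"
  shows "poly (bernstein_monom n m) s = (\<Sum>j\<le>n. bernstein_node n j ^ m * bernstein_weight n j s)"
proof (induction m arbitrary: s)
  case 0
  have "(\<Sum>j\<le>n. bernstein_weight n j s) = ((1 + s) / 2 + (1 - s) / 2) ^ n"
    unfolding binomial_ring bernstein_weight_def by simp
  also have "(1 + s) / 2 + (1 - s) / 2 = 1" by (simp add: field_simps)
  finally show ?case by simp
next
  case (Suc m)
  have "\<exists>d. \<forall>j\<le>n. (bernstein_weight n j has_real_derivative d j) (at s) \<and>
    (1 - s\<^sup>2) * d j = (2 * real j - real n - real n * s) * bernstein_weight n j s"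
    by (meson bernstein_weight_deriv)
  then obtain d where d: "\<And>j. j \<le> n \<Longrightarrow> (bernstein_weight n j has_real_derivative d j) (at s)"
    "\<And>j. j \<le> n \<Longrightarrow> (1 - s\<^sup>2) * d j = (2 * real j - real n - real n * s) * bernstein_weight n j s"
    by blast
  have "((\<lambda>s. \<Sum>j\<le>n. bernstein_node n j ^ m * bernstein_weight n j s) has_real_derivative
      (\<Sum>j\<le>n. bernstein_node n j ^ m * d j)) (at s)"
    by (auto intro!: derivative_eq_intros d sum.cong)
  then have "(poly (bernstein_monom n m) has_real_derivative (\<Sum>j\<le>n. bernstein_node n j ^ m * d j)) (at s)"
    by (simp add: Suc.IH[abs_def])
  then have dd: "poly (pderiv (bernstein_monom n m)) s = (\<Sum>j\<le>n. bernstein_node n j ^ m * d j)"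
    using DERIV_unique poly_DERIV by blast
  have "poly (bernstein_monom n (Suc m)) s = s * poly (bernstein_monom n m) s +
      (1 - s\<^sup>2) * poly (pderiv (bernstein_monom n m)) s / real n"
    by (simp add: field_simps power2_eq_square)
  also have "\<dots> = (\<Sum>j\<le>n. bernstein_node n j ^ m *
      (s * bernstein_weight n j s + ((1 - s\<^sup>2) * d j) / real n))"
    unfolding Suc.IH dd
    by (simp add: sum_distrib_left sum_divide_distrib sum.distrib algebra_simps)
  also have "\<dots> = (\<Sum>j\<le>n. bernstein_node n j ^ Suc m * bernstein_weight n j s)"
  proof (rule sum.cong)
    fix j assume "j \<in> {..n}"
    then have "(1 - s\<^sup>2) * d j = (2 * real j - real n - real n * s) * bernstein_weight n j s"
      by (intro d) simp
    then have "s * bernstein_weight n j s + ((1 - s\<^sup>2) * d j) / real n = bernstein_node n j * bernstein_weight n j s"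
      using assms by (simp only:) (simp add: bernstein_node_def field_simps)
    then show "bernstein_node n j ^ m * (s * bernstein_weight n j s + ((1 - s\<^sup>2) * d j) / real n)
      = bernstein_node n j ^ Suc m * bernstein_weight n j s" by simp
  qed simp
  finally show ?case .
qed

text \<open>The bound is uniform in \<open>n\<close>, so only finitely many coefficients matter in
  the limit.\<close>

lemma degree_bernstein_monom: "degree (bernstein_monom n m) \<le> m"
proof (induction m)
  case (Suc m)
  let ?p = "bernstein_monom n m"
  have d: "degree (pderiv ?p) \<le> m - 1" using Suc by (auto simp: degree_pderiv)
  have "degree (pCons 0 (pCons 0 (pderiv ?p))) \<le> Suc m"
  proof (cases "pderiv ?p = 0")
    case False
    \<comment> \<open>Rules out truncation in \<open>m - 1\<close>, so that two shifts of the
      derivative give degree at most \<open>m + 1\<close>.\<close>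
    then have "m \<noteq> 0" using Suc by (auto simp: pderiv_eq_0_iff)
    then show ?thesis using d False by simp
  qed simp
  moreover have "degree (pCons 0 ?p) \<le> Suc m" using Suc by simp
  ultimately show ?case using d
    by (auto intro!: degree_add_le degree_diff_le order.trans[OF degree_smult_le])
qed simp

text \<open>The term with factor \<open>1 / real n\<close> vanishes in the limit, and what is left
  of the recursion is multiplication by the variable. Coefficients are compared because the
  functional applied later is linear but not known to be continuous.\<close>

lemma coeff_bernstein_monom_tendsto:
  "(\<lambda>n. coeff (bernstein_monom n m) i) \<longlonglongrightarrow> coeff (monom 1 m) i"
proof (induction m arbitrary: i)
  case (Suc m)
  have d: "(\<lambda>n. coeff (pderiv (bernstein_monom n m)) i) \<longlonglongrightarrow> coeff (pderiv (monom 1 m)) i" for i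
    unfolding coeff_pderiv by (intro tendsto_intros Suc)
  have s: "(\<lambda>n. coeff (pCons 0 (p n)) i) \<longlonglongrightarrow> coeff (pCons 0 q) i"
    if "\<And>i. (\<lambda>n. coeff (p n) i) \<longlonglongrightarrow> coeff q i" for p :: "nat \<Rightarrow> real poly" and q i
    using that by (cases i) auto
  have "(\<lambda>n. coeff (bernstein_monom n (Suc m)) i) \<longlonglongrightarrow> coeff (pCons 0 (monom 1 m)) i +
      0 * (coeff (pderiv (monom 1 m)) i - coeff (pCons 0 (pCons 0 (pderiv (monom 1 m)))) i)"
    unfolding bernstein_monom.simps coeff_add coeff_smult coeff_diff
    by (intro tendsto_intros lim_1_over_n s d Suc)
  then show ?case by (simp add: monom_Suc)
qed simp

section \<open>A space-filling curve\<close>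

text \<open>The distance from \<open>t\<close> to the nearest even integer. Written with
  \<open>arccos\<close> and \<open>cos\<close>, it is visibly continuous and of period 2.\<close>

definition triangle_wave :: "real \<Rightarrow> real" where
  "triangle_wave t = arccos (cos (pi * t)) / pi"

text \<open>
  Schoenberg's curve: \<open>digit_wave (3 ^ N * t)\<close> reads off the ternary digits of \<open>t\<close> (all \<open>0\<close> or \<open>2\<close>),
  and a coordinate collects the digits at the positions \<open>e 0, e 1, \<dots>\<close> as a binary expansion.
\<close>

definition digit_wave :: "real \<Rightarrow> real" where
  "digit_wave t = max 0 (min 1 (3 * triangle_wave t - 1))"

definition schoenberg_coord :: "(nat \<Rightarrow> nat) \<Rightarrow> real \<Rightarrow> real" where
  "schoenberg_coord e t = suminf (\<lambda>m. digit_wave (3 ^ e m * t) / 2 ^ Suc m)"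

text \<open>For \<open>a\<close> with values 0 and 1 this is a point of the Cantor set; it avoids
  the open middle third, where \<open>digit_wave\<close> takes intermediate values.\<close>

definition ternary_value :: "(nat \<Rightarrow> nat) \<Rightarrow> real" where
  "ternary_value a = suminf (\<lambda>k. 2 * real (a k) / 3 ^ Suc k)"

lemma triangle_wave_eq: "0 \<le> t \<Longrightarrow> t \<le> 1 \<Longrightarrow> triangle_wave t = t"
  unfolding triangle_wave_def by (subst arccos_cos) (auto simp: mult_le_cancel_left1)

lemma triangle_wave_shift: "triangle_wave (t + 2 * real k) = triangle_wave t"
proof -
  have "cos (pi * (t + 2 * real k)) = cos (pi * t)"
    using cos.plus_of_nat[of "pi * t" k] by (simp add: algebra_simps)
  then show ?thesis by (simp add: triangle_wave_def)
qed

lemma digit_wave_shift: "digit_wave (t + 2 * real k) = digit_wave t"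
  by (simp add: digit_wave_def triangle_wave_shift)

lemma continuous_on_triangle_wave: "continuous_on UNIV triangle_wave"
  unfolding triangle_wave_def[abs_def] by (intro continuous_intros) auto

lemma continuous_on_digit_wave: "continuous_on UNIV digit_wave"
  unfolding digit_wave_def[abs_def] by (intro continuous_intros continuous_on_triangle_wave)

lemma digit_wave_bounds: "0 \<le> digit_wave t" "digit_wave t \<le> 1"
  by (auto simp: digit_wave_def)

lemma continuous_on_schoenberg_coord: "continuous_on UNIV (schoenberg_coord e)"
  unfolding schoenberg_coord_def[abs_def]
proof (rule uniform_limit_theorem[OF _ Weierstrass_m_test[where M = "\<lambda>m. (1/2) ^ Suc m"]])
  show "\<forall>\<^sub>F n in sequentially. continuous_on UNIV (\<lambda>t. \<Sum>m<n. digit_wave (3 ^ e m * t) / 2 ^ Suc m)"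
    by (intro always_eventually allI continuous_intros continuous_on_compose2[OF continuous_on_digit_wave]) auto
  show "norm (digit_wave (3 ^ e m * t) / 2 ^ Suc m) \<le> (1/2) ^ Suc m" for m t
    using digit_wave_bounds[of "3 ^ e m * t"] by (simp add: power_divide divide_simps)
  show "summable (\<lambda>m. (1/2 :: real) ^ Suc m)"
    using summable_mult[OF summable_geometric[of "1/2 :: real"]] by simp
qed auto

lemma ternary_value:
  assumes a: "\<And>k. a k \<le> 1"
  shows ternary_value_bounds: "0 \<le> ternary_value a" "ternary_value a \<le> 1"
    and ternary_value_rec: "3 * ternary_value a = 2 * real (a 0) + ternary_value (\<lambda>k. a (Suc k))"
proof -
  have g: "(\<lambda>k. 2 / 3 * (1 / 3) ^ k) sums (1 :: real)"
    using sums_mult[OF geometric_sums[of "1/3 :: real"], of "2/3"] by simp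
  have le: "2 * real (a k) / 3 ^ Suc k \<le> 2 / 3 * (1 / 3) ^ k" 
    if "\<And>k. a k \<le> (1 :: nat)" for k a
    using that[of k] by (simp add: power_divide divide_simps)
  have sm: "summable (\<lambda>k. 2 * real (a k) / 3 ^ Suc k)" 
    if "\<And>k. a k \<le> (1 :: nat)" for a
    by (rule summable_comparison_test_ev[OF _ sums_summable[OF g]])
      (use le[of a, OF that] in auto)
  show "0 \<le> ternary_value a" unfolding ternary_value_def
    by (intro suminf_nonneg sm a) auto
  have "ternary_value a \<le> suminf (\<lambda>k. 2 / 3 * (1 / 3) ^ k)" unfolding ternary_value_def
    by (intro suminf_le sm a le sums_summable[OF g])
  then show "ternary_value a \<le> 1" using sums_unique[OF g] by simp
  have "ternary_value a = 2 * real (a 0) / 3 + suminf (\<lambda>k. 2 * real (a (Suc k)) / 3 ^ Suc (Suc k))"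
    unfolding ternary_value_def using suminf_split_head[OF sm[of a, OF a]] by simp
  also have "suminf (\<lambda>k. 2 * real (a (Suc k)) / 3 ^ Suc (Suc k)) = ternary_value (\<lambda>k. a (Suc k)) / 3"
    unfolding ternary_value_def
    using suminf_divide[OF sm[of "\<lambda>k. a (Suc k)", OF a], of 3] by simp
  finally show "3 * ternary_value a = 2 * real (a 0) + ternary_value (\<lambda>k. a (Suc k))" by simp
qed

text \<open>Multiplication by \<open>3 ^ N\<close> moves the first \<open>N\<close> digits in front
  of the point. All digits being 0 or 2, they form an even integer, which the wave ignores; the rest
  is at most 1/3 or at least 2/3 according to \<open>a N\<close>.\<close>

lemma digit_wave_ternary_value:
  assumes a: "\<And>k. a k \<le> 1"
  shows "digit_wave (3 ^ N * ternary_value a) = real (a N)"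
proof -
  have "\<exists>K. 3 ^ N * ternary_value a = ternary_value (\<lambda>k. a (k + N)) + 2 * real K"
  proof (induction N)
    case 0
    show ?case by (rule exI[of _ 0]) simp
  next
    case (Suc N)
    then obtain K where K: "3 ^ N * ternary_value a = ternary_value (\<lambda>k. a (k + N)) + 2 * real K" by blast
    have "3 ^ Suc N * ternary_value a = 3 * ternary_value (\<lambda>k. a (k + N)) + 6 * real K"
      using K by simp
    also have "3 * ternary_value (\<lambda>k. a (k + N)) = 2 * real (a N) + ternary_value (\<lambda>k. a (k + Suc N))"
      using ternary_value_rec[of "\<lambda>k. a (k + N)"] a by simp
    finally show ?case by (intro exI[of _ "3 * K + a N"]) simp
  qed
  then obtain K where K: "3 ^ N * ternary_value a = ternary_value (\<lambda>k. a (k + N)) + 2 * real K" by blast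
  let ?v = "ternary_value (\<lambda>k. a (k + N))" and ?w = "ternary_value (\<lambda>k. a (Suc k + N))"
  have v: "0 \<le> ?v" "?v \<le> 1" "3 * ?v = 2 * real (a N) + ?w" "0 \<le> ?w" "?w \<le> 1"
    using ternary_value_bounds[of "\<lambda>k. a (k + N)"] ternary_value_rec[of "\<lambda>k. a (k + N)"]
      ternary_value_bounds[of "\<lambda>k. a (Suc k + N)"] a by auto
  have "digit_wave ?v = real (a N)"
  proof (cases "a N = 0")
    case False
    then have "a N = 1" using a[of N] by simp
    then show ?thesis using v by (simp add: digit_wave_def triangle_wave_eq)
  qed (use v in \<open>simp add: digit_wave_def triangle_wave_eq\<close>)
  then show ?thesis unfolding K digit_wave_shift .
qed

text \<open>The digits are the parities of the floors of \<open>2 ^ Suc m * v\<close>, so the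
  partial sums are truncations of \<open>v\<close> at binary places.\<close>

lemma binary_digits:
  fixes v :: real
  assumes "0 \<le> v" "v < 1"
  obtains a :: "nat \<Rightarrow> nat" where "\<And>m. a m \<le> 1" "(\<lambda>m. real (a m) / 2 ^ Suc m) sums v"
proof -
  define a where "a m = nat (\<lfloor>2 ^ Suc m * v\<rfloor> mod 2)" for m
  have le: "a m \<le> 1" for m unfolding a_def by auto
  have ps: "(\<Sum>m<n. real (a m) / 2 ^ Suc m) = of_int \<lfloor>2 ^ n * v\<rfloor> / 2 ^ n" for n
  proof (induction n)
    case 0
    \<comment> \<open>Here \<open>v < 1\<close> enters: the integer part, which no digit records, is
      0.\<close>
    then show ?case using assms by (simp add: floor_eq_iff)
  next
    case (Suc n)
    have "\<lfloor>2 ^ Suc n * v\<rfloor> div 2 = \<lfloor>2 ^ n * v\<rfloor>"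
      using floor_divide_real_eq_div[of 2 "2 ^ Suc n * v"] by simp
    then have "\<lfloor>2 ^ Suc n * v\<rfloor> = 2 * \<lfloor>2 ^ n * v\<rfloor> + int (a n)"
      unfolding a_def by (metis mult_div_mod_eq nat_0_le pos_mod_sign zero_less_numeral)
    then show ?case using Suc by (simp add: field_simps)
  qed
  have "(\<lambda>n. of_int \<lfloor>2 ^ n * v\<rfloor> / 2 ^ n) \<longlonglongrightarrow> v"
  proof (rule tendsto_sandwich)
    show "\<forall>\<^sub>F n in sequentially. v - (1/2) ^ n \<le> of_int \<lfloor>2 ^ n * v\<rfloor> / 2 ^ n"
    proof (intro always_eventually allI)
      fix n
      have "v - (1/2) ^ n = (2 ^ n * v - 1) / 2 ^ n" by (simp add: diff_divide_distrib power_one_over inverse_eq_divide)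
      also have "\<dots> \<le> of_int \<lfloor>2 ^ n * v\<rfloor> / 2 ^ n" by (intro divide_right_mono) (linarith, simp)
      finally show "v - (1/2) ^ n \<le> of_int \<lfloor>2 ^ n * v\<rfloor> / 2 ^ n" .
    qed
    show "\<forall>\<^sub>F n in sequentially. of_int \<lfloor>2 ^ n * v\<rfloor> / 2 ^ n \<le> v"
      by (intro always_eventually allI) (simp add: field_simps)
    show "(\<lambda>n. v - (1/2) ^ n) \<longlonglongrightarrow> v"
      using tendsto_diff[OF tendsto_const[of v] LIMSEQ_power_zero[of "1/2 :: real"]] by simp
  qed simp
  then have "(\<lambda>m. real (a m) / 2 ^ Suc m) sums v"
    unfolding sums_def ps .
  with le show ?thesis by (rule that)
qed

text \<open>The linear bound on the right inverse \<open>\<tau>\<close> turns bounded second moments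
  in space into tightness on the line. \<open>\<tau>\<close> is a mere choice function; it will be
  applied to \<open>measure_pmf\<close>, for which every function is measurable.\<close>

lemma space_filling_line:
  obtains D :: "real \<Rightarrow> real ^ 'n::finite" and \<tau> :: "real ^ 'n \<Rightarrow> real" where
    "continuous_on UNIV D" "\<And>x. D (\<tau> x) = x" "\<And>x. \<bar>\<tau> x\<bar> \<le> 2 * norm x + 3"
proof -
  obtain idx :: "'n \<Rightarrow> nat" where idx: "inj idx"
    using finite_imp_inj_to_nat_seg[of "UNIV :: 'n set"] by auto
  define y where "y i = schoenberg_coord (\<lambda>m. prod_encode (m, idx i))" for i
  \<comment> \<open>For \<open>t\<close> from \<open>2 k\<close> to \<open>2 k + 1\<close> the
    factor \<open>t - triangle_wave t\<close> equals \<open>2 k\<close>, and this stretch of the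
    curve reaches every \<open>x\<close> with \<open>norm x < real k\<close>.\<close>
  define D :: "real \<Rightarrow> real ^ 'n" where
    "D t = (\<chi> i. (t - triangle_wave t) * (2 * y i t - 1))" for t
  have "continuous_on UNIV D"
    unfolding D_def[abs_def] y_def
    by (intro continuous_intros continuous_on_triangle_wave continuous_on_schoenberg_coord)
  moreover have "\<exists>t. D t = x \<and> \<bar>t\<bar> \<le> 2 * norm x + 3" for x
  proof -
    define k where "k = Suc (nat \<lfloor>norm x\<rfloor>)"
    have k: "norm x < real k" "real k \<le> norm x + 1"
      unfolding k_def using norm_ge_zero[of x] by linarith+
    \<comment> \<open>The solution of \<open>2 * real k * (2 * v i - 1) = x $ i\<close>.\<close>
    define v where "v i = (x $ i / (2 * real k) + 1) / 2" for i
    have "0 \<le> v i \<and> v i < 1" for i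
    proof -
      have "\<bar>x $ i\<bar> < real k" using component_le_norm_cart[of x i] k by linarith
      then show ?thesis unfolding v_def by (auto simp: field_simps)
    qed
    then have "\<exists>a. (\<forall>m. a m \<le> (1::nat)) \<and> (\<lambda>m. real (a m) / 2 ^ Suc m) sums v i" for i
      using binary_digits[of "v i"] by metis
    then obtain a :: "'n \<Rightarrow> nat \<Rightarrow> nat" where a: "\<And>i m. a i m \<le> 1" "\<And>i. (\<lambda>m. real (a i m) / 2 ^ Suc m) sums v i"
      by metis
    \<comment> \<open>A single digit sequence interleaves those of all coordinates by Cantor
      pairing.\<close>
    define b where "b N = (case prod_decode N of (m, j) \<Rightarrow> a (inv idx j) m)" for N
    have b1: "b N \<le> 1" for N unfolding b_def case_prod_beta by (rule a)
    have b: "b (prod_encode (m, idx i)) = a i m" for m i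
      unfolding b_def by (simp add: idx)
    define s where "s = ternary_value b"
    have s: "0 \<le> s" "s \<le> 1" unfolding s_def using ternary_value_bounds b1 by auto
    define t where "t = s + 2 * real k"
    have yv: "y i t = v i" for i
    proof -
      have "digit_wave (3 ^ prod_encode (m, idx i) * t) = real (a i m)" for m
      proof -
        let ?N = "prod_encode (m, idx i)"
        have "3 ^ ?N * t = 3 ^ ?N * s + 2 * real (3 ^ ?N * k)"
          by (simp add: t_def algebra_simps)
        then have "digit_wave (3 ^ ?N * t) = digit_wave (3 ^ ?N * s)"
          by (simp only: digit_wave_shift)
        also have "\<dots> = real (a i m)"
          unfolding s_def by (subst digit_wave_ternary_value[OF b1]) (simp add: b)
        finally show ?thesis .
      qed
      then show ?thesis unfolding y_def schoenberg_coord_def using sums_unique[OF a(2)[of i]] by simp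
    qed
    have "triangle_wave t = s"
      unfolding t_def triangle_wave_shift using s by (rule triangle_wave_eq)
    then have "D t $ i = 2 * real k * (2 * v i - 1)" for i
      by (simp add: D_def yv) (simp add: t_def)
    then have "D t $ i = x $ i" for i
      using k norm_ge_zero[of x] by (simp add: v_def field_simps)
    then have "D t = x" by (simp add: vec_eq_iff)
    moreover have "\<bar>t\<bar> \<le> 2 * norm x + 3" using k s unfolding t_def by simp
    ultimately show ?thesis by blast
  qed
  then obtain \<tau> where "\<And>x. D (\<tau> x) = x \<and> \<bar>\<tau> x\<bar> \<le> 2 * norm x + 3" by metis
  ultimately show ?thesis using that by blast
qed

section \<open>Haviland's theorem\<close>

text \<open>A normalised functional on an algebra of functions, positive on pointwise nonnegative
  functions and not merely on squares. The approximation by finitely supported measures works at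
  this generality.\<close>

locale state_on_functions =
  fixes V :: "('a \<Rightarrow> real) set" and \<Lambda> :: "('a \<Rightarrow> real) \<Rightarrow> real"
  assumes V_const: "(\<lambda>x. c) \<in> V"
    and V_add: "f \<in> V \<Longrightarrow> g \<in> V \<Longrightarrow> (\<lambda>x. f x + g x) \<in> V"
    and V_mult: "f \<in> V \<Longrightarrow> g \<in> V \<Longrightarrow> (\<lambda>x. f x * g x) \<in> V"
    and add: "f \<in> V \<Longrightarrow> g \<in> V \<Longrightarrow> \<Lambda> (\<lambda>x. f x + g x) = \<Lambda> f + \<Lambda> g"
    and scale: "f \<in> V \<Longrightarrow> \<Lambda> (\<lambda>x. c * f x) = c * \<Lambda> f"
    and pos: "f \<in> V \<Longrightarrow> (\<And>x. 0 \<le> f x) \<Longrightarrow> 0 \<le> \<Lambda> f"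
    and one: "\<Lambda> (\<lambda>x. 1) = 1"
begin

lemma V_scale: "f \<in> V \<Longrightarrow> (\<lambda>x. c * f x) \<in> V"
  using V_mult[OF V_const] .

lemma V_sum: "finite A \<Longrightarrow> (\<And>i. i \<in> A \<Longrightarrow> f i \<in> V) \<Longrightarrow> (\<lambda>x. \<Sum>i\<in>A. f i x) \<in> V"
  by (induction A rule: finite_induct) (auto simp: V_const V_add)

lemma const: "\<Lambda> (\<lambda>x. c) = c"
  using scale[OF V_const[of 1], of c] one by simp

lemma sum:
  "finite A \<Longrightarrow> (\<And>i. i \<in> A \<Longrightarrow> f i \<in> V) \<Longrightarrow> \<Lambda> (\<lambda>x. \<Sum>i\<in>A. f i x) = (\<Sum>i\<in>A. \<Lambda> (f i))"
  by (induction A rule: finite_induct) (auto simp: const add V_sum)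

text \<open>
  If \<open>I\<close> is the infimum of the squared error \<open>Q\<close>, moving a near-minimiser \<open>\<nu>\<close> towards a point mass
  cannot push \<open>Q\<close> below \<open>I\<close>. This says that a certain function in \<open>V\<close> is nonnegative,
  and applying \<open>\<Lambda>\<close> to it kills the first-order term, which forces \<open>I = 0\<close>.
\<close>

lemma finite_pmf_approx:
  assumes S: "finite S" "S \<subseteq> V" and \<epsilon>: "0 < \<epsilon>"
  obtains \<nu> where "finite (set_pmf \<nu>)" "(\<Sum>g\<in>S. (measure_pmf.expectation \<nu> g - \<Lambda> g)\<^sup>2) < \<epsilon>"
proof -
  define Q where "Q \<nu> = (\<Sum>g\<in>S. (measure_pmf.expectation \<nu> g - \<Lambda> g)\<^sup>2)" for \<nu>
  \<comment> \<open>\<open>W x\<close> is the error \<open>Q\<close> of the point mass at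
    \<open>x\<close>.\<close>
  define W where "W x = (\<Sum>g\<in>S. (g x - \<Lambda> g)\<^sup>2)" for x
  define I where "I = Inf (Q ` {\<nu>. finite (set_pmf \<nu>)})"
  have Q0: "0 \<le> Q \<nu>" for \<nu> unfolding Q_def by (intro sum_nonneg) simp
  have bdd: "bdd_below (Q ` {\<nu>. finite (set_pmf \<nu>)})" using Q0 by (intro bdd_belowI[of _ 0]) auto
  have ne: "{\<nu> :: 'a pmf. finite (set_pmf \<nu>)} \<noteq> {}" by (auto intro!: exI[of _ "return_pmf undefined"])
  have I_le: "I \<le> Q \<nu>" if "finite (set_pmf \<nu>)" for \<nu>
    unfolding I_def using that by (intro cInf_lower bdd) auto
  have gV: "g \<in> V" if "g \<in> S" for g using S that by auto
  have g_shift: "(\<lambda>x. g x - \<Lambda> g) \<in> V" "\<Lambda> (\<lambda>x. g x - \<Lambda> g) = 0" if "g \<in> S" for g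
    using V_add[OF gV[OF that] V_const[of "- \<Lambda> g"]] add[OF gV[OF that] V_const[of "- \<Lambda> g"]]
    by (simp_all add: const)
  have WV: "W \<in> V" unfolding W_def[abs_def]
    by (intro V_sum S) (auto simp: power2_eq_square intro!: V_mult g_shift)
  define K where "K = \<Lambda> W"
  have K0: "0 \<le> K" unfolding K_def by (intro pos WV) (auto simp: W_def intro!: sum_nonneg)
  have key: "I \<le> (1 - s)\<^sup>2 * Q \<nu> + s\<^sup>2 * K" if s: "0 \<le> s" "s \<le> 1" and \<nu>: "finite (set_pmf \<nu>)" for s \<nu>
  proof -
    define e where "e g = measure_pmf.expectation \<nu> g - \<Lambda> g" for g
    \<comment> \<open>\<open>h x\<close> is \<open>Q \<nu>' - I\<close> for the mixture
      \<open>\<nu>'\<close> below, which gives weight \<open>s\<close> to the point mass at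
      \<open>x\<close>.\<close>
    define h where "h x = ((1 - s)\<^sup>2 * Q \<nu> - I) + (2 * s * (1 - s) * (\<Sum>g\<in>S. e g * (g x - \<Lambda> g)) + s\<^sup>2 * W x)" for x
    have lV: "(\<lambda>x. \<Sum>g\<in>S. e g * (g x - \<Lambda> g)) \<in> V"
      by (intro V_sum S V_scale g_shift)
    have hV: "h \<in> V" unfolding h_def[abs_def]
      by (intro V_add V_const V_scale lV WV)
    have "0 \<le> h x" for x
    proof -
      define \<nu>' where "\<nu>' = bernoulli_pmf s \<bind> (\<lambda>b. if b then return_pmf x else \<nu>)"
      have fin: "finite (set_pmf \<nu>')" unfolding \<nu>'_def using \<nu> by (auto simp: set_bind_pmf)
      have ex: "measure_pmf.expectation \<nu>' g = s * g x + (1 - s) * measure_pmf.expectation \<nu> g" for g :: "'a \<Rightarrow> real"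
        unfolding \<nu>'_def using \<nu> s
        by (subst pmf_expectation_bind[of UNIV]) (auto simp: UNIV_bool)
      have "I \<le> Q \<nu>'" by (rule I_le[OF fin])
      also have "Q \<nu>' = (\<Sum>g\<in>S. ((1 - s) * e g + s * (g x - \<Lambda> g))\<^sup>2)"
        unfolding Q_def ex e_def by (intro sum.cong refl arg_cong[where f = "\<lambda>x. x\<^sup>2"]) (simp add: algebra_simps)
      also have "\<dots> = (1 - s)\<^sup>2 * Q \<nu> + 2 * s * (1 - s) * (\<Sum>g\<in>S. e g * (g x - \<Lambda> g)) + s\<^sup>2 * W x"
        unfolding Q_def W_def e_def[symmetric] sum_distrib_left sum.distrib[symmetric]
        by (intro sum.cong refl) (simp add: power2_eq_square algebra_simps)
      finally show ?thesis by (simp add: h_def)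
    qed
    then have "0 \<le> \<Lambda> h" by (intro pos hV)
    also have "\<Lambda> h = ((1 - s)\<^sup>2 * Q \<nu> - I) +
        (2 * s * (1 - s) * \<Lambda> (\<lambda>x. \<Sum>g\<in>S. e g * (g x - \<Lambda> g)) + s\<^sup>2 * K)"
      unfolding h_def[abs_def] K_def
      by (simp add: add scale const V_add V_const V_scale lV WV)
    also have "\<Lambda> (\<lambda>x. \<Sum>g\<in>S. e g * (g x - \<Lambda> g)) = 0"
      using S by (subst sum) (auto simp: scale g_shift intro!: V_scale g_shift)
    finally show ?thesis by simp
  qed
  have key': "I \<le> (1 - s)\<^sup>2 * I + s\<^sup>2 * K" if s: "0 \<le> s" "s \<le> 1" for s
  proof (rule field_le_epsilon)
    fix \<delta> :: real assume \<delta>: "0 < \<delta>"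
    have "Inf (Q ` {\<nu>. finite (set_pmf \<nu>)}) < I + \<delta>" unfolding I_def[symmetric] using \<delta> by simp
    then obtain \<nu> where \<nu>: "finite (set_pmf \<nu>)" "Q \<nu> < I + \<delta>"
      using cInf_lessD[of "Q ` {\<nu>. finite (set_pmf \<nu>)}" "I + \<delta>"] ne by auto
    have "(1 - s)\<^sup>2 * Q \<nu> \<le> (1 - s)\<^sup>2 * (I + \<delta>)" using \<nu> by (intro mult_left_mono) auto
    also have "\<dots> \<le> (1 - s)\<^sup>2 * I + \<delta>"
    proof -
      have "(1 - s)\<^sup>2 \<le> 1" using s by (intro power_le_one) auto
      from mult_right_mono[OF this, of \<delta>] show ?thesis using \<delta> by (simp add: algebra_simps)
    qed
    finally show "I \<le> (1 - s)\<^sup>2 * I + s\<^sup>2 * K + \<delta>" using key[OF s \<nu>(1)] by simp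
  qed
  have I0: "0 \<le> I" unfolding I_def using Q0 ne by (intro cInf_greatest) auto
  have "I \<le> 0"
  proof (rule ccontr)
    assume "\<not> I \<le> 0"
    \<comment> \<open>Dividing the inequality \<open>key'\<close> by \<open>s\<close> leaves
      \<open>(2 - s) * I \<le> s * K\<close>, which fails for this small \<open>s\<close> if
      \<open>I\<close> is positive. The 1 in \<open>K + 1\<close> guards against
      \<open>K = 0\<close>.\<close>
    define s where "s = min 1 (I / (2 * (K + 1)))"
    have s: "0 < s" "s \<le> 1" using \<open>\<not> I \<le> 0\<close> K0 by (auto simp: s_def)
    have "s * (K + 1) \<le> I / (2 * (K + 1)) * (K + 1)" using K0 by (intro mult_right_mono) (auto simp: s_def)
    also have "\<dots> = I / 2" using K0 by (simp add: field_simps)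
    finally have "s * K < I" using \<open>\<not> I \<le> 0\<close> s by (simp add: algebra_simps)
    have "s * ((2 - s) * I) \<le> s * (s * K)" using key'[of s] s by (simp add: power2_eq_square algebra_simps)
    then have "(2 - s) * I \<le> s * K" using s by (simp add: mult_le_cancel_left)
    moreover have "1 * I \<le> (2 - s) * I" using s I0 by (intro mult_right_mono) auto
    ultimately show False using \<open>s * K < I\<close> by simp
  qed
  then have "Inf (Q ` {\<nu>. finite (set_pmf \<nu>)}) < \<epsilon>" using \<epsilon> by (simp add: I_def)
  then obtain \<nu> where "finite (set_pmf \<nu>)" "Q \<nu> < \<epsilon>"
    using cInf_lessD[of "Q ` {\<nu>. finite (set_pmf \<nu>)}" \<epsilon>] ne by auto
  then show ?thesis using that by (simp add: Q_def)
qed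

end

section \<open>Convergence of expectations under weak limits\<close>

text \<open>Bounded second moments give uniform integrability: cutting \<open>G\<close> off at
  height \<open>R\<close> changes an expectation by at most the second moment over \<open>R\<close>.
  Weak convergence handles the cut-off function, and then \<open>R\<close> tends to
  infinity.\<close>

lemma weak_limit_expectation:
  fixes G :: "real \<Rightarrow> real"
  assumes N: "\<And>n. real_distribution (N n)" and P: "real_distribution P" and weak: "weak_conv_m N P"
    and cont: "continuous_on UNIV G"
    and int: "\<And>n. integrable (N n) G" "\<And>n. integrable (N n) (\<lambda>t. (G t)\<^sup>2)"
    and lim: "(\<lambda>n. \<integral>t. G t \<partial>N n) \<longlonglongrightarrow> l" and lim2: "(\<lambda>n. \<integral>t. (G t)\<^sup>2 \<partial>N n) \<longlonglongrightarrow> m"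
  shows "integrable P G \<and> (\<integral>t. G t \<partial>P) = l"
proof -
  interpret P: real_distribution P by fact
  interpret N: real_distribution "N n" for n by fact
  have [measurable]: "G \<in> borel_measurable borel"
    using cont by (rule borel_measurable_continuous_onI)
  have conv: "(\<lambda>n. \<integral>t. f t \<partial>N n) \<longlonglongrightarrow> (\<integral>t. f t \<partial>P)"
    if "continuous_on UNIV f" "\<And>t. norm (f t) \<le> B" for f :: "real \<Rightarrow> real" and B
    using that by (intro weak_conv_imp_integral_bdd_continuous_conv[OF N P weak, of f B])
      (auto simp: continuous_on_eq_continuous_at)
  have bint: "integrable P f" if "f \<in> borel_measurable borel" "\<And>t. \<bar>f t\<bar> \<le> B" for f :: "real \<Rightarrow> real" and B
    using that by (intro P.integrable_const_bound[of _ B]) auto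
  have bintN: "integrable (N n) f" if "f \<in> borel_measurable borel" "\<And>t. \<bar>f t\<bar> \<le> B" for f :: "real \<Rightarrow> real" and B n
    using that by (intro N.integrable_const_bound[of _ B]) auto
  \<comment> \<open>Weak convergence only tests bounded continuous functions. Monotone convergence
    in \<open>k\<close> then bounds the second moment under \<open>P\<close>.\<close>
  define h where "h k t = min (real k) ((G t)\<^sup>2)" for k t
  have h_le: "(\<integral>t. h k t \<partial>P) \<le> m" for k
  proof (rule tendsto_le[OF _ lim2])
    show "(\<lambda>n. \<integral>t. h k t \<partial>N n) \<longlonglongrightarrow> (\<integral>t. h k t \<partial>P)"
      unfolding h_def by (intro conv[of _ "real k"] continuous_intros cont) auto
    show "\<forall>\<^sub>F n in sequentially. (\<integral>t. h k t \<partial>N n) \<le> (\<integral>t. (G t)\<^sup>2 \<partial>N n)"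
      by (intro always_eventually allI integral_mono int bintN[of _ "real k"]) (auto simp: h_def)
  qed simp
  have hi: "integrable P (h k)" for k
    unfolding h_def by (intro bint[of _ "real k"]) auto
  have "incseq (\<lambda>k. \<integral>t. h k t \<partial>P)"
    by (intro incseq_SucI integral_mono hi) (auto simp: h_def)
  then obtain x where x: "(\<lambda>k. \<integral>t. h k t \<partial>P) \<longlonglongrightarrow> x"
    using incseq_convergent h_le by blast
  have mono: "AE t in P. mono (\<lambda>k. h k t)"
    by (auto simp: mono_def h_def)
  have hlim: "AE t in P. (\<lambda>k. h k t) \<longlonglongrightarrow> (G t)\<^sup>2"
  proof (intro AE_I2 tendsto_eventually)
    fix t
    obtain k0 where "(G t)\<^sup>2 \<le> real k0" using real_arch_simple by blast
    then show "\<forall>\<^sub>F k in sequentially. h k t = (G t)\<^sup>2"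
      by (intro eventually_sequentiallyI[of k0]) (auto simp: h_def min_def)
  qed
  have meas: "(\<lambda>t. (G t)\<^sup>2) \<in> borel_measurable P" by simp
  have G2: "integrable P (\<lambda>t. (G t)\<^sup>2)"
    by (rule integrable_monotone_convergence[OF hi mono hlim x meas])
  have "(\<integral>t. (G t)\<^sup>2 \<partial>P) = x"
    by (rule integral_monotone_convergence[OF hi mono hlim x meas])
  then have G2m: "(\<integral>t. (G t)\<^sup>2 \<partial>P) \<le> m"
    using LIMSEQ_le_const2[OF x] h_le by auto
  have Gi: "integrable P G"
    using P.square_integrable_imp_integrable[OF _ G2] by simp
  define c where "c R t = max (- R) (min R (G t))" for R t
  have c_cont: "continuous_on UNIV (c R)" for R
    unfolding c_def by (intro continuous_intros cont)
  then have [measurable]: "c R \<in> borel_measurable borel" for R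
    by (rule borel_measurable_continuous_onI)
  have c_bd: "\<bar>c R t\<bar> \<le> R" if "R > 0" for R t using that by (auto simp: c_def)
  have c_diff: "\<bar>G t - c R t\<bar> \<le> (G t)\<^sup>2 / R" if "R > 0" for R t
  proof (cases "\<bar>G t\<bar> \<le> R")
    case False
    then have "\<bar>G t - c R t\<bar> \<le> \<bar>G t\<bar>" using that by (auto simp: c_def)
    also have "\<bar>G t\<bar> * R \<le> \<bar>G t\<bar> * \<bar>G t\<bar>" using False by (intro mult_left_mono) auto
    then have "\<bar>G t\<bar> \<le> (G t)\<^sup>2 / R" using that by (simp add: field_simps power2_eq_square)
    finally show ?thesis .
  qed (use that in \<open>auto simp: c_def\<close>)
  have gen: "\<bar>(\<integral>t. G t \<partial>M) - (\<integral>t. c R t \<partial>M)\<bar> \<le> (\<integral>t. (G t)\<^sup>2 \<partial>M) / R"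
    if "R > 0" "integrable M G" "integrable M (c R)" "integrable M (\<lambda>t. (G t)\<^sup>2)" for M R
  proof -
    have "(\<integral>t. G t \<partial>M) - (\<integral>t. c R t \<partial>M) = (\<integral>t. G t - c R t \<partial>M)"
      using that by simp
    also have "\<bar>\<dots>\<bar> \<le> (\<integral>t. \<bar>G t - c R t\<bar> \<partial>M)" by (rule integral_abs_bound)
    also have "\<dots> \<le> (\<integral>t. (G t)\<^sup>2 / R \<partial>M)"
      using that c_diff by (intro integral_mono) auto
    finally show ?thesis by simp
  qed
  have "\<bar>(\<integral>t. G t \<partial>P) - l\<bar> \<le> 2 * m / R" if R: "R > 0" for R
  proof -
    have "\<bar>(\<integral>t. G t \<partial>P) - (\<integral>t. c R t \<partial>P)\<bar> \<le> (\<integral>t. (G t)\<^sup>2 \<partial>P) / R"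
      using R by (intro gen Gi G2 bint[of _ R] c_bd) auto
    also have "\<dots> \<le> m / R" using G2m R by (intro divide_right_mono) auto
    finally have 1: "\<bar>(\<integral>t. G t \<partial>P) - (\<integral>t. c R t \<partial>P)\<bar> \<le> m / R" .
    have "\<bar>l - (\<integral>t. c R t \<partial>P)\<bar> \<le> m / R"
    proof (rule tendsto_le)
      show "(\<lambda>n. \<bar>(\<integral>t. G t \<partial>N n) - (\<integral>t. c R t \<partial>N n)\<bar>) \<longlonglongrightarrow> \<bar>l - (\<integral>t. c R t \<partial>P)\<bar>"
        using c_bd[OF R] by (intro tendsto_intros lim conv[of _ R] c_cont) auto
      show "(\<lambda>n. (\<integral>t. (G t)\<^sup>2 \<partial>N n) / R) \<longlonglongrightarrow> m / R"
        using R by (intro tendsto_intros lim2) auto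
      show "\<forall>\<^sub>F n in sequentially. \<bar>(\<integral>t. G t \<partial>N n) - (\<integral>t. c R t \<partial>N n)\<bar> \<le> (\<integral>t. (G t)\<^sup>2 \<partial>N n) / R"
        using R by (intro always_eventually allI gen int bintN[of _ R] c_bd) auto
    qed simp
    with 1 show ?thesis by linarith
  qed
  then have "\<forall>\<^sub>F k in sequentially. \<bar>(\<integral>t. G t \<partial>P) - l\<bar> \<le> 2 * m / real k"
    by (intro eventually_sequentiallyI[of 1]) auto
  then have "\<bar>(\<integral>t. G t \<partial>P) - l\<bar> \<le> 0"
    by (intro tendsto_lowerbound[OF lim_const_over_n]) auto
  with Gi show ?thesis by simp
qed

section \<open>Polynomial functions\<close>

text \<open>Generation by monomials and sums alone leaves inductions with one monomial case and one
  additive case; products follow in \<open>polyfun_mult\<close>.\<close>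

inductive_set polyfun :: "(real ^ 'n::finite \<Rightarrow> real) set" where
  monom: "(\<lambda>x. c * (\<Prod>i\<in>UNIV. (x $ i) ^ \<alpha> i)) \<in> polyfun"
| add: "f \<in> polyfun \<Longrightarrow> g \<in> polyfun \<Longrightarrow> (\<lambda>x. f x + g x) \<in> polyfun"

lemma polyfun_const: "(\<lambda>x. c) \<in> polyfun"
  using polyfun.monom[of c "\<lambda>_. 0"] by simp

lemma polyfun_monom: "(\<lambda>x. \<Prod>i\<in>UNIV. (x $ i) ^ \<alpha> i) \<in> polyfun"
  using polyfun.monom[of 1] by simp

lemma polyfun_component: "(\<lambda>x. x $ i) \<in> polyfun"
proof -
  have "(\<Prod>j\<in>UNIV. (x $ j) ^ (if j = i then 1 else 0)) = x $ i" for x :: "real ^ 'a"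
    by (simp add: if_distrib[of "(^) _"] cong: if_cong)
  then show ?thesis using polyfun_monom[of "\<lambda>j. if j = i then 1 else 0"] by simp
qed

lemma polyfun_mult:
  assumes "f \<in> polyfun" "g \<in> polyfun"
  shows "(\<lambda>x. f x * g x) \<in> polyfun"
  using assms
proof (induction f rule: polyfun.induct)
  case (monom c \<alpha>)
  from \<open>g \<in> polyfun\<close> show ?case
  proof (induction g rule: polyfun.induct)
    case (monom d \<beta>)
    show ?case using polyfun.monom[of "c * d" "\<lambda>i. \<alpha> i + \<beta> i"]
      by (simp add: power_add prod.distrib algebra_simps)
  next
    case (add f g)
    then show ?case using polyfun.add[OF add.IH] by (simp add: algebra_simps)
  qed
next
  case (add f1 f2)
  then show ?case using polyfun.add[of "\<lambda>x. f1 x * g x" "\<lambda>x. f2 x * g x"] by (simp add: algebra_simps)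
qed

lemma polyfun_sum: "finite A \<Longrightarrow> (\<And>i. i \<in> A \<Longrightarrow> f i \<in> polyfun) \<Longrightarrow> (\<lambda>x. \<Sum>i\<in>A. f i x) \<in> polyfun"
  by (induction A rule: finite_induct) (auto simp: polyfun_const polyfun.add)

lemma continuous_on_polyfun: "f \<in> polyfun \<Longrightarrow> continuous_on S f"
  by (induction rule: polyfun.induct) (auto intro!: continuous_intros)

lemma norm_square_cart: "(norm x)\<^sup>2 = (\<Sum>i\<in>UNIV. (x $ i)\<^sup>2)" for x :: "real ^ 'n"
  by (simp add: norm_vec_def L2_set_def sum_nonneg)

lemma polyfun_norm_square: "(\<lambda>x. (norm x)\<^sup>2) \<in> polyfun"
proof -
  have "(norm x)\<^sup>2 = (\<Sum>i\<in>UNIV. x $ i * x $ i)" for x :: "real ^ 'a"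
    unfolding norm_square_cart by (simp add: power2_eq_square)
  then show ?thesis
    using polyfun_sum[of UNIV "\<lambda>i x. x $ i * x $ i"] by (simp add: polyfun_mult polyfun_component)
qed

lemma poly_eval_superset:
  assumes "finite K" "Poly_Mapping.keys p \<subseteq> K"
  shows "poly_eval p x =
    (\<Sum>m\<in>K. Poly_Mapping.lookup p m * (\<Prod>i\<in>UNIV. (x $ i) ^ Poly_Mapping.lookup m i))"
  unfolding poly_eval_def using assms
  by (intro sum.mono_neutral_left) (auto simp: in_keys_iff)

lemma poly_eval_add: "poly_eval (p + q) x = poly_eval p x + poly_eval q x"
proof -
  let ?K = "Poly_Mapping.keys p \<union> Poly_Mapping.keys q"
  have "Poly_Mapping.keys (p + q) \<subseteq> ?K" by (rule keys_add)
  then show ?thesis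
    by (simp add: poly_eval_superset[of ?K] lookup_add sum.distrib algebra_simps)
qed

text \<open>Allows polynomials to be replaced by functions. Every exponent function is a
  \<open>poly_mapping\<close> because the index type is finite.\<close>

lemma range_poly_eval: "range poly_eval = polyfun"
proof (intro equalityI subsetI)
  fix f :: "real ^ 'a \<Rightarrow> real"
  assume "f \<in> range poly_eval"
  then obtain p where "f = poly_eval p" by auto
  then show "f \<in> polyfun"
    unfolding poly_eval_def[abs_def] by (auto intro!: polyfun_sum polyfun.monom)
next
  fix f :: "real ^ 'a \<Rightarrow> real"
  assume "f \<in> polyfun"
  then show "f \<in> range poly_eval"
  proof (induction rule: polyfun.induct)
    case (monom c \<alpha>)
    have "poly_eval (Poly_Mapping.single (Abs_poly_mapping \<alpha>) c) x = c * (\<Prod>i\<in>UNIV. (x $ i) ^ \<alpha> i)" for x :: "real ^ 'a"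
      by (subst poly_eval_superset[of "{Abs_poly_mapping \<alpha>}"]) (auto simp: Abs_poly_mapping_inverse)
    then show ?case by (metis (no_types, lifting) ext rangeI)
  next
    case (add f g)
    then obtain p q where "f = poly_eval p" "g = poly_eval q" by auto
    then have "(\<lambda>x. f x + g x) = poly_eval (p + q)" by (auto simp: poly_eval_add)
    then show ?case by auto
  qed
qed

text \<open>Squares of polynomial functions are polynomial functions, so second moments of the
  approximating measures converge too and \<open>weak_limit_expectation\<close> applies to
  \<open>f\<close> composed with \<open>D\<close>. As \<open>D\<close> undoes \<open>\<tau>\<close>,
  the limit pushed forward by \<open>D\<close> has the right moments.\<close>

lemma haviland_prob:
  fixes \<Lambda> :: "(real ^ 'n::finite \<Rightarrow> real) \<Rightarrow> real"
  assumes "state_on_functions polyfun \<Lambda>"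
  obtains M where "prob_space M" "sets M = sets (borel :: (real ^ 'n) measure)"
    "\<And>f. f \<in> polyfun \<Longrightarrow> integrable M f \<and> (\<integral>x. f x \<partial>M) = \<Lambda> f"
proof -
  interpret state_on_functions polyfun \<Lambda> by fact
  \<comment> \<open>Finite sets of monomials, each monomial belonging to all but finitely many of
    them.\<close>
  define S where "S n = (\<lambda>\<alpha> (x :: real ^ 'n). \<Prod>i\<in>UNIV. (x $ i) ^ \<alpha> i) ` (\<Pi>\<^sub>E i\<in>(UNIV :: 'n set). {..n})" for n :: nat
  have S: "finite (S n)" "S n \<subseteq> polyfun" for n
    unfolding S_def by (auto intro!: finite_PiE polyfun_monom)
  have "\<exists>\<nu>. finite (set_pmf \<nu>) \<and> (\<Sum>g\<in>S n. (measure_pmf.expectation \<nu> g - \<Lambda> g)\<^sup>2) < 1 / real (Suc n)" for n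
    using finite_pmf_approx[OF S, of "1 / real (Suc n)" n] by (metis of_nat_0_less_iff zero_less_Suc zero_less_divide_1_iff)
  then obtain \<nu> where fin: "\<And>n. finite (set_pmf (\<nu> n))"
    and appr: "\<And>n. (\<Sum>g\<in>S n. (measure_pmf.expectation (\<nu> n) g - \<Lambda> g)\<^sup>2) < 1 / real (Suc n)"
    by metis
  note [simp] = integrable_measure_pmf_finite[OF fin]
  have lim: "(\<lambda>n. measure_pmf.expectation (\<nu> n) f) \<longlonglongrightarrow> \<Lambda> f" if "f \<in> polyfun" for f
    using that
  proof (induction rule: polyfun.induct)
    case (monom c \<alpha>)
    define f where "f = (\<lambda>x :: real ^ 'n. \<Prod>i\<in>UNIV. (x $ i) ^ \<alpha> i)"
    have f: "f \<in> S n" if "n \<ge> Max (range \<alpha>)" for n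
      unfolding S_def f_def using that by (intro imageI) (auto intro: order.trans[OF Max_ge])
    have "(\<lambda>n. (measure_pmf.expectation (\<nu> n) f - \<Lambda> f)\<^sup>2) \<longlonglongrightarrow> 0"
    proof (rule tendsto_sandwich[OF _ _ tendsto_const LIMSEQ_inverse_real_of_nat])
      show "\<forall>\<^sub>F n in sequentially. (measure_pmf.expectation (\<nu> n) f - \<Lambda> f)\<^sup>2 \<le> inverse (real (Suc n))"
      proof (rule eventually_sequentiallyI[of "Max (range \<alpha>)"])
        fix n assume "n \<ge> Max (range \<alpha>)"
        then have "(measure_pmf.expectation (\<nu> n) f - \<Lambda> f)\<^sup>2 \<le> (\<Sum>g\<in>S n. (measure_pmf.expectation (\<nu> n) g - \<Lambda> g)\<^sup>2)"
          by (intro member_le_sum f S) auto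
        then show "(measure_pmf.expectation (\<nu> n) f - \<Lambda> f)\<^sup>2 \<le> inverse (real (Suc n))"
          using appr[of n] by (simp add: inverse_eq_divide)
      qed
    qed auto
    then have "(\<lambda>n. measure_pmf.expectation (\<nu> n) f - \<Lambda> f) \<longlonglongrightarrow> 0"
      using tendsto_real_sqrt[of "\<lambda>n. (measure_pmf.expectation (\<nu> n) f - \<Lambda> f)\<^sup>2" 0] by (simp add: tendsto_rabs_zero_iff)
    then have "(\<lambda>n. c * measure_pmf.expectation (\<nu> n) f) \<longlonglongrightarrow> c * \<Lambda> f"
      by (intro tendsto_intros) (simp add: LIM_zero_iff)
    moreover have "\<Lambda> (\<lambda>x. c * f x) = c * \<Lambda> f" by (intro scale) (simp add: f_def polyfun_monom)
    ultimately show ?case by (simp add: f_def)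
  next
    case (add f g)
    then show ?case
      by (simp add: state_on_functions.add[OF assms]) (intro tendsto_intros)
  qed
  \<comment> \<open>Helly's selection theorem concerns the line, so the measures are transported there along \<open>\<tau>\<close>.\<close>
  obtain D :: "real \<Rightarrow> real ^ 'n" and \<tau> where D: "continuous_on UNIV D" "\<And>x. D (\<tau> x) = x" "\<And>x. \<bar>\<tau> x\<bar> \<le> 2 * norm x + 3"
    using space_filling_line by blast
  have [measurable]: "D \<in> borel_measurable borel"
    using D(1) by (rule borel_measurable_continuous_onI)
  define N where "N n = distr (measure_pmf (\<nu> n)) borel \<tau>" for n
  have N: "real_distribution (N n)" for n
    unfolding N_def real_distribution_def real_distribution_axioms_def
    by (auto intro!: measure_pmf.prob_space_distr)
  \<comment> \<open>By \<open>(a + b)\<^sup>2 \<le> 2 a\<^sup>2 + 2 b\<^sup>2\<close> this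
    polynomial dominates the square of the bound on \<open>\<bar>\<tau> x\<bar>\<close>.\<close>
  define w where "w x = 18 + 8 * (norm x)\<^sup>2" for x :: "real ^ 'n"
  have wP: "w \<in> polyfun" unfolding w_def[abs_def]
    by (intro polyfun.add polyfun_const polyfun_mult polyfun_norm_square)
  obtain K where K: "\<And>n. \<bar>measure_pmf.expectation (\<nu> n) w\<bar> \<le> K"
    using convergent_imp_Bseq[OF convergentI[OF lim[OF wP]]] by (auto simp: Bseq_def)
  have "tight N"
    unfolding tight_def
  proof (intro conjI allI impI N)
    fix \<epsilon> :: real assume \<epsilon>: "0 < \<epsilon>"
    \<comment> \<open>The argument is Markov's inequality with tail bound \<open>K / R\<close>;
      taking \<open>K + 1\<close> here makes it strictly smaller than
      \<open>\<epsilon>\<close>.\<close>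
    define R where "R = max 1 ((K + 1) / \<epsilon>)"
    have R: "1 \<le> R" "K + 1 \<le> R * \<epsilon>" using \<epsilon> by (auto simp: R_def field_simps max_def)
    have "measure (N n) {-R<..R} > 1 - \<epsilon>" for n
    proof -
      let ?A = "\<tau> -` {-R<..R}"
      have "1 - indicator ?A x \<le> w x / R" for x
      proof (cases "x \<in> ?A")
        case False
        then have "R \<le> \<bar>\<tau> x\<bar>" by auto
        then have "R * 1 \<le> \<bar>\<tau> x\<bar> * \<bar>\<tau> x\<bar>" using R by (intro mult_mono) auto
        also have "\<dots> \<le> (2 * norm x + 3) * (2 * norm x + 3)" using D(3)[of x] by (intro mult_mono) auto
        also have "\<dots> \<le> w x"
          using sum_squares_ge_zero[of "2 * norm x - 3" 0] by (simp add: w_def power2_eq_square algebra_simps)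
        finally show ?thesis using False R by (simp add: field_simps)
      qed (use R in \<open>simp add: w_def\<close>)
      then have "measure_pmf.expectation (\<nu> n) (\<lambda>x. 1 - indicator ?A x) \<le> measure_pmf.expectation (\<nu> n) (\<lambda>x. w x / R)"
        by (intro integral_mono) auto
      also have "\<dots> = measure_pmf.expectation (\<nu> n) w / R" by simp
      also have "\<dots> \<le> K / R" using K[of n] R by (intro divide_right_mono) auto
      also have "\<dots> < \<epsilon>" using R by (simp add: field_simps)
      also have "measure_pmf.expectation (\<nu> n) (\<lambda>x. 1 - indicator ?A x) = 1 - measure (\<nu> n) ?A"
        by simp
      finally show ?thesis unfolding N_def by (subst measure_distr) auto
    qed
    then show "\<exists>a b. a < b \<and> (\<forall>n. 1 - \<epsilon> < measure (N n) {a<..b})"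
      using R by (intro exI[of _ "-R"] exI[of _ R]) auto
  qed
  then obtain r P where r: "strict_mono r" and P: "real_distribution P" and weak: "weak_conv_m (N \<circ> id \<circ> r) P"
    using tight_imp_convergent_subsubsequence[of N id] by (auto simp: strict_mono_def)
  interpret P: real_distribution P by fact
  have PD: "integrable P (\<lambda>t. f (D t)) \<and> (\<integral>t. f (D t) \<partial>P) = \<Lambda> f" if f: "f \<in> polyfun" for f
  proof (rule weak_limit_expectation[of "N \<circ> id \<circ> r"])
    have c: "continuous_on UNIV (\<lambda>t. g (D t))" if "g \<in> polyfun" for g
      using continuous_on_compose2[OF continuous_on_polyfun[OF that, of UNIV] D(1)] by simp
    have "(\<lambda>t. g (D t)) \<in> borel_measurable borel" if "g \<in> polyfun" for g
      using c[OF that] by (rule borel_measurable_continuous_onI)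
    then have i: "integrable (N n) (\<lambda>t. g (D t))" "(\<integral>t. g (D t) \<partial>N n) = measure_pmf.expectation (\<nu> n) g"
      if "g \<in> polyfun" for g n
      unfolding N_def using that by (subst integrable_distr_eq integral_distr; auto simp: D)+
    have f2: "(\<lambda>x. (f x)\<^sup>2) \<in> polyfun" using polyfun_mult[OF f f] by (simp add: power2_eq_square)
    show "continuous_on UNIV (\<lambda>t. f (D t))" by (rule c[OF f])
    show "integrable ((N \<circ> id \<circ> r) n) (\<lambda>t. f (D t))" for n by (simp add: i f)
    show "integrable ((N \<circ> id \<circ> r) n) (\<lambda>t. (f (D t))\<^sup>2)" for n using i(1)[OF f2] by simp
    show "(\<lambda>n. \<integral>t. f (D t) \<partial>(N \<circ> id \<circ> r) n) \<longlonglongrightarrow> \<Lambda> f"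
      using LIMSEQ_subseq_LIMSEQ[OF lim[OF f] r] by (simp add: i f o_def)
    show "(\<lambda>n. \<integral>t. (f (D t))\<^sup>2 \<partial>(N \<circ> id \<circ> r) n) \<longlonglongrightarrow> \<Lambda> (\<lambda>x. (f x)\<^sup>2)"
      using LIMSEQ_subseq_LIMSEQ[OF lim[OF f2] r] i(2)[OF f2] by (simp add: o_def)
    show "real_distribution ((N \<circ> id \<circ> r) n)" for n by (simp add: N)
  qed (fact P weak)+
  show ?thesis
  proof (rule that[of "distr P borel D"])
    show "prob_space (distr P borel D)" by (intro P.prob_space_distr) simp
    fix f :: "real ^ 'n \<Rightarrow> real" assume f: "f \<in> polyfun"
    have "f \<in> borel_measurable borel"
      using continuous_on_polyfun[OF f] by (rule borel_measurable_continuous_onI)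
    then show "integrable (distr P borel D) f \<and> (\<integral>x. f x \<partial>distr P borel D) = \<Lambda> f"
      using PD[OF f] by (simp add: integrable_distr_eq integral_distr)
  qed simp
qed

section \<open>Positivity on nonnegative polynomials\<close>

definition polar :: "real ^ 'n::finite \<Rightarrow> real \<times> (real ^ 'n)" where
  "polar x = (norm x, x /\<^sub>R norm x)"

text \<open>For \<open>x \<noteq> 0\<close> the points \<open>polar x\<close> and
  \<open>- polar x\<close> are the two pairs of a real number and a unit vector whose product is
  \<open>x\<close>.\<close>

definition even_part :: "(real \<times> (real ^ 'n::finite) \<Rightarrow> real) \<Rightarrow> real ^ 'n \<Rightarrow> real" where
  "even_part g x = (g (polar x) + g (- polar x)) / 2"

definition odd_part :: "(real \<times> (real ^ 'n::finite) \<Rightarrow> real) \<Rightarrow> real ^ 'n \<Rightarrow> real" where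
  "odd_part g x = (g (polar x) - g (- polar x)) / 2"

text \<open>Calculations can thus use total functions; the value at the origin is ignored.\<close>

definition in_extended_algebra :: "(real ^ 'n::finite \<Rightarrow> real) \<Rightarrow> bool" where
  "in_extended_algebra f \<longleftrightarrow> restrict f punctured_space \<in> extended_algebra"

lemma in_extended_algebra_cong:
  "in_extended_algebra f \<Longrightarrow> (\<And>x. x \<noteq> 0 \<Longrightarrow> f x = g x) \<Longrightarrow> in_extended_algebra g"
  unfolding in_extended_algebra_def punctured_space_def by (metis (no_types, lifting) DiffD2 insertI1 restrict_ext)

lemma in_extended_algebra_const: "in_extended_algebra (\<lambda>x. c)"
  unfolding in_extended_algebra_def extended_algebra_def by (rule generated_algebra.const)

lemma in_extended_algebra_add:
  "in_extended_algebra f \<Longrightarrow> in_extended_algebra g \<Longrightarrow> in_extended_algebra (\<lambda>x. f x + g x)"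
  unfolding in_extended_algebra_def extended_algebra_def
  by (drule (1) generated_algebra.add) (simp cong: restrict_cong)

lemma in_extended_algebra_mult:
  "in_extended_algebra f \<Longrightarrow> in_extended_algebra g \<Longrightarrow> in_extended_algebra (\<lambda>x. f x * g x)"
  unfolding in_extended_algebra_def extended_algebra_def
  by (drule (1) generated_algebra.mult) (simp cong: restrict_cong)

lemma in_extended_algebra_sum:
  "finite I \<Longrightarrow> (\<And>i. i \<in> I \<Longrightarrow> in_extended_algebra (f i)) \<Longrightarrow> in_extended_algebra (\<lambda>x. \<Sum>i\<in>I. f i x)"
  by (induction I rule: finite_induct) (auto simp: in_extended_algebra_const in_extended_algebra_add)

lemma in_extended_algebra_polyfun: "f \<in> polyfun \<Longrightarrow> in_extended_algebra f"
  unfolding in_extended_algebra_def extended_algebra_def range_poly_eval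
  by (intro generated_algebra.gen) simp

lemma in_extended_algebra_sphere_fun: "in_extended_algebra (sphere_fun k l)"
  unfolding in_extended_algebra_def extended_algebra_def by (intro generated_algebra.gen) auto

lemma sum_direction_squares: "x \<noteq> 0 \<Longrightarrow> (\<Sum>k\<in>UNIV. (x $ k / norm x)\<^sup>2) = 1" for x :: "real ^ 'n"
  by (simp add: power_divide sum_divide_distrib[symmetric] norm_square_cart[symmetric])

lemma polar_eq_sum:
  "polar x = norm x *\<^sub>R (1, 0) + (\<Sum>k\<in>UNIV. (x $ k / norm x) *\<^sub>R (0, axis k 1))"
proof -
  have "(\<Sum>k\<in>UNIV. (x $ k / norm x) *\<^sub>R (axis k 1 :: real ^ 'a)) = x /\<^sub>R norm x"
    by (simp add: vec_eq_iff axis_def if_distrib cong: if_cong) (simp add: field_simps)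
  then show ?thesis
    by (simp add: polar_def sum_prod[of "\<lambda>k. 0 :: real", symmetric] zero_prod_def prod_eq_iff fst_sum snd_sum)
qed

text \<open>An odd part need not lie in the algebra, but its product with a direction component is
  even. Both claims go through the induction together: a product of two odd parts is a sum of
  products of such even terms, because the squared components add up to 1.\<close>

lemma even_odd_part_in_extended_algebra:
  assumes "real_polynomial_function g"
  shows "in_extended_algebra (even_part g) \<and> (\<forall>l. in_extended_algebra (\<lambda>x. odd_part g x * (x $ l / norm x)))"
  using assms
proof (induction rule: real_polynomial_function.induct)
  case (linear g)
  interpret g: bounded_linear g by fact
  have "even_part g = (\<lambda>x. 0)" by (auto simp: even_part_def g.neg)
  moreover have "in_extended_algebra (\<lambda>x. odd_part g x * (x $ l / norm x))" for l
  proof (rule in_extended_algebra_cong)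
    \<comment> \<open>Multiplied by \<open>x $ l / norm x\<close>, the radius becomes
      \<open>x $ l\<close> and the \<open>k\<close>-th direction component becomes
      \<open>sphere_fun k l\<close>.\<close>
    show "in_extended_algebra (\<lambda>x. x $ l * g (1, 0) + (\<Sum>k\<in>UNIV. sphere_fun k l x * g (0, axis k 1)))"
      by (intro in_extended_algebra_add in_extended_algebra_mult in_extended_algebra_sum in_extended_algebra_sphere_fun
          in_extended_algebra_const in_extended_algebra_polyfun polyfun_component) auto
    fix x :: "real ^ 'a" assume "x \<noteq> 0"
    then have "sphere_fun k l x = (x $ k / norm x) * (x $ l / norm x)" for k
      unfolding sphere_fun_def norm_square_cart[symmetric] by (simp add: field_simps power2_eq_square)
    moreover have "odd_part g x = norm x * g (1, 0) + (\<Sum>k\<in>UNIV. (x $ k / norm x) * g (0, axis k 1))"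
    proof -
      have "odd_part g x = g (polar x)" by (simp add: odd_part_def g.neg)
      then show ?thesis by (simp only: polar_eq_sum g.add g.sum g.scaleR real_scaleR_def)
    qed
    ultimately show "x $ l * g (1, 0) + (\<Sum>k\<in>UNIV. sphere_fun k l x * g (0, axis k 1)) = odd_part g x * (x $ l / norm x)"
      using \<open>x \<noteq> 0\<close> by (simp add: algebra_simps sum_distrib_left sum_divide_distrib)
  qed
  ultimately show ?case by (simp add: in_extended_algebra_const)
next
  case (const c)
  have "even_part (\<lambda>x. c) = (\<lambda>x :: real ^ 'a. c)" "odd_part (\<lambda>x. c) = (\<lambda>x :: real ^ 'a. 0)"
    by (auto simp: even_part_def odd_part_def)
  then show ?case by (simp add: in_extended_algebra_const)
next
  case (add f g)
  have "even_part (\<lambda>x. f x + g x) = (\<lambda>x. even_part f x + even_part g x)"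
    "odd_part (\<lambda>x. f x + g x) = (\<lambda>x. odd_part f x + odd_part g x)"
    by (auto simp: even_part_def odd_part_def field_simps)
  then show ?case using add.IH by (auto simp only: distrib_right intro!: in_extended_algebra_add)
next
  case (mult f g)
  have ef: "in_extended_algebra (even_part f)" and eg: "in_extended_algebra (even_part g)"
    and odf: "in_extended_algebra (\<lambda>x. odd_part f x * (x $ l / norm x))"
    and odg: "in_extended_algebra (\<lambda>x. odd_part g x * (x $ l / norm x))" for l
    using mult.IH by blast+
  have o: "odd_part (\<lambda>x. f x * g x) x * (x $ l / norm x) =
      even_part f x * (odd_part g x * (x $ l / norm x)) + (odd_part f x * (x $ l / norm x)) * even_part g x" for l x
  proof -
    have "odd_part (\<lambda>x. f x * g x) x = even_part f x * odd_part g x + odd_part f x * even_part g x"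
      by (simp add: even_part_def odd_part_def field_simps)
    then show ?thesis by (simp only:) (simp add: algebra_simps)
  qed
  have "in_extended_algebra (even_part (\<lambda>x. f x * g x))"
  proof (rule in_extended_algebra_cong)
    show "in_extended_algebra (\<lambda>x. even_part f x * even_part g x +
        (\<Sum>l\<in>UNIV. (odd_part f x * (x $ l / norm x)) * (odd_part g x * (x $ l / norm x))))"
      by (intro in_extended_algebra_add in_extended_algebra_sum finite in_extended_algebra_mult[OF ef eg]
          in_extended_algebra_mult[OF odf odg])
    fix x :: "real ^ 'a" assume "x \<noteq> 0"
    have "(\<Sum>l\<in>UNIV. (odd_part f x * (x $ l / norm x)) * (odd_part g x * (x $ l / norm x))) =
       odd_part f x * odd_part g x * (\<Sum>l\<in>UNIV. (x $ l / norm x)\<^sup>2)"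
      unfolding sum_distrib_left by (intro sum.cong) (auto simp: power2_eq_square)
    then have o2: "(\<Sum>l\<in>UNIV. (odd_part f x * (x $ l / norm x)) * (odd_part g x * (x $ l / norm x))) =
       odd_part f x * odd_part g x"
      by (simp only: sum_direction_squares[OF \<open>x \<noteq> 0\<close>] mult_1_right)
    show "even_part f x * even_part g x +
        (\<Sum>l\<in>UNIV. (odd_part f x * (x $ l / norm x)) * (odd_part g x * (x $ l / norm x))) = even_part (\<lambda>x. f x * g x) x"
      unfolding o2 by (simp add: even_part_def odd_part_def field_simps)
  qed
  moreover have "in_extended_algebra (\<lambda>x. odd_part (\<lambda>x. f x * g x) x * (x $ l / norm x))" for l
    unfolding o by (intro in_extended_algebra_add in_extended_algebra_mult[OF ef odg] in_extended_algebra_mult[OF odf eg])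
  ultimately show ?case by blast
qed

section \<open>Polynomials in radius and direction\<close>

lemma real_polynomial_function_fst: "real_polynomial_function (\<lambda>y :: real \<times> (real ^ 'n). fst y)"
  by (rule real_polynomial_function.intros(1)[OF bounded_linear_fst])

lemma real_polynomial_function_snd_nth: "real_polynomial_function (\<lambda>y :: real \<times> (real ^ 'n). snd y $ k)"
  by (rule real_polynomial_function.intros(1)[OF bounded_linear_compose[OF bounded_linear_vec_nth bounded_linear_snd]])

lemma real_polynomial_function_poly:
  "real_polynomial_function f \<Longrightarrow> real_polynomial_function (\<lambda>y. poly q (f y))"
  by (induction q) auto

lemmas real_polynomial_function_polar_intros =
  real_polynomial_function.intros(2-4)
  real_polynomial_function_diff real_polynomial_function_power real_polynomial_function_sum
  real_polynomial_function_prod real_polynomial_function_divide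
  real_polynomial_function_fst real_polynomial_function_snd_nth real_polynomial_function_poly

lemma poly_eq_sum_coeff:
  fixes q :: "real poly"
  assumes "degree q \<le> N"
  shows "poly q s = (\<Sum>l\<le>N. coeff q l * s ^ l)"
  unfolding poly_altdef using assms
  by (intro sum.mono_neutral_left) (auto simp: coeff_eq_0)

lemma polyfun_along_line:
  assumes "f \<in> polyfun"
  obtains q :: "real poly" where "\<And>r. f (r *\<^sub>R v) = poly q r"
proof -
  from assms have "\<exists>q. \<forall>r. f (r *\<^sub>R v) = poly q r"
  proof (induction rule: polyfun.induct)
    case (monom c \<alpha>)
    show ?case
      by (intro exI[of _ "smult (c * (\<Prod>i\<in>UNIV. (v $ i) ^ \<alpha> i)) (monom 1 (\<Sum>i\<in>UNIV. \<alpha> i))"])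
        (simp add: poly_monom power_mult_distrib prod.distrib power_sum)
  next
    case (add f g)
    then obtain p q where "\<forall>r. f (r *\<^sub>R v) = poly p r" "\<forall>r. g (r *\<^sub>R v) = poly q r" by blast
    then show ?case by (intro exI[of _ "p + q"]) simp
  qed
  then show ?thesis using that by blast
qed

lemma polyfun_polar: "f \<in> polyfun \<Longrightarrow> real_polynomial_function (\<lambda>y. f (fst y *\<^sub>R snd y))"
proof (induction rule: polyfun.induct)
  case (monom c \<alpha>)
  show ?case unfolding vector_scaleR_component real_scaleR_def
    by (intro real_polynomial_function_polar_intros) auto
qed (rule real_polynomial_function.intros(3))

text \<open>Only the direction is discretised. The radius stays exact, so each coefficient is
  \<open>f\<close> along a line through the origin, a univariate polynomial.\<close>

definition bernstein_approx ::
  "nat \<Rightarrow> (real ^ 'n::finite \<Rightarrow> real) \<Rightarrow> real \<times> (real ^ 'n) \<Rightarrow> real" where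
  "bernstein_approx n f y = (\<Sum>j\<in>(\<Pi>\<^sub>E i\<in>UNIV. {..n}).
     f (fst y *\<^sub>R (\<chi> i. bernstein_node n (j i))) * (\<Prod>i\<in>UNIV. bernstein_weight n (j i) (snd y $ i)))"

lemma real_polynomial_function_bernstein_term:
  assumes "f \<in> polyfun"
  shows "real_polynomial_function (\<lambda>y :: real \<times> (real ^ 'n::finite).
    f (fst y *\<^sub>R v) * (\<Prod>i\<in>UNIV. bernstein_weight n (j i) (snd y $ i)))"
proof -
  obtain q where q: "\<And>r. f (r *\<^sub>R v) = poly q r" using polyfun_along_line[OF assms] by blast
  show ?thesis unfolding q bernstein_weight_def
    by (intro real_polynomial_function_polar_intros) auto
qed

lemma real_polynomial_function_bernstein_approx:
  "f \<in> polyfun \<Longrightarrow> real_polynomial_function (bernstein_approx n f)"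
  unfolding bernstein_approx_def[abs_def]
  by (intro real_polynomial_function_sum real_polynomial_function_bernstein_term finite_PiE) auto

lemma bernstein_approx_monom:
  assumes "n > 0"
  shows "bernstein_approx n (\<lambda>x. c * (\<Prod>i\<in>UNIV. (x $ i) ^ \<alpha> i)) =
    (\<lambda>y. c * fst y ^ (\<Sum>i\<in>UNIV. \<alpha> i) * (\<Prod>i\<in>UNIV. poly (bernstein_monom n (\<alpha> i)) (snd y $ i)))"
  unfolding poly_bernstein_monom[OF assms] bernstein_approx_def[abs_def]
  by (rule ext, subst prod_sum_PiE)
    (auto simp: sum_distrib_left power_mult_distrib prod.distrib power_sum mult_ac intro!: sum.cong)

section \<open>The functional in polar coordinates\<close>

locale positive_extension =
  fixes F :: "(real ^ 'n::finite \<Rightarrow> real) \<Rightarrow> real"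
  assumes lin: "linear_functional_on punctured_space extended_algebra F"
    and pos: "positive_functional_on punctured_space extended_algebra F"
begin

definition F_restrict where "F_restrict f = F (restrict f punctured_space)"

lemma F_restrict_cong: "(\<And>x. x \<noteq> 0 \<Longrightarrow> f x = g x) \<Longrightarrow> F_restrict f = F_restrict g"
  unfolding F_restrict_def punctured_space_def by (metis (no_types, lifting) DiffD2 insertI1 restrict_ext)

lemma F_restrict_add: 
  assumes "in_extended_algebra f" "in_extended_algebra g"
  shows "F_restrict (\<lambda>x. f x + g x) = F_restrict f + F_restrict g"
proof -
  have "F (\<lambda>x\<in>punctured_space. restrict f punctured_space x + restrict g punctured_space x) = F_restrict f + F_restrict g"
    using lin assms unfolding linear_functional_on_def in_extended_algebra_def F_restrict_def by blast
  then show ?thesis by (simp add: F_restrict_def cong: restrict_cong)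
qed

lemma F_restrict_scale: 
  assumes "in_extended_algebra f"
  shows "F_restrict (\<lambda>x. c * f x) = c * F_restrict f"
proof -
  have "F (\<lambda>x\<in>punctured_space. c * restrict f punctured_space x) = c * F_restrict f"
    using lin assms unfolding linear_functional_on_def in_extended_algebra_def F_restrict_def by blast
  then show ?thesis by (simp add: F_restrict_def cong: restrict_cong)
qed

lemma F_restrict_square: 
  assumes "in_extended_algebra f"
  shows "0 \<le> F_restrict (\<lambda>x. (f x)\<^sup>2)"
proof -
  have "0 \<le> F (\<lambda>x\<in>punctured_space. (restrict f punctured_space x)\<^sup>2)"
    using pos assms unfolding positive_functional_on_def in_extended_algebra_def by blast
  then show ?thesis by (simp add: F_restrict_def cong: restrict_cong)
qed

lemma F_restrict_sum:
  "finite I \<Longrightarrow> (\<And>i. i \<in> I \<Longrightarrow> in_extended_algebra (f i)) \<Longrightarrow> F_restrict (\<lambda>x. \<Sum>i\<in>I. f i x) = (\<Sum>i\<in>I. F_restrict (f i))"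
proof (induction I rule: finite_induct)
  case empty
  then show ?case using F_restrict_scale[OF in_extended_algebra_const, of 0 0] by simp
qed (auto simp: F_restrict_add in_extended_algebra_sum)

definition F_polar where "F_polar g = F_restrict (even_part g)"

lemma even_part_in [simp]: "real_polynomial_function g \<Longrightarrow> in_extended_algebra (even_part g)"
  using even_odd_part_in_extended_algebra by blast

text \<open>Away from the origin both points entering \<open>even_part\<close> have a direction of
  norm 1. The equation of the sphere may therefore be used inside \<open>F_polar\<close>.\<close>

lemma F_polar_cong: "(\<And>r s. norm s = 1 \<Longrightarrow> f (r, s) = g (r, s)) \<Longrightarrow> F_polar f = F_polar g"
  unfolding F_polar_def by (intro F_restrict_cong) (simp add: even_part_def polar_def)

lemma F_polar_add: "real_polynomial_function f \<Longrightarrow> real_polynomial_function g \<Longrightarrow> F_polar (\<lambda>y. f y + g y) = F_polar f + F_polar g"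
  unfolding F_polar_def by (subst F_restrict_add[symmetric]) (auto simp: even_part_def field_simps intro!: F_restrict_cong)

lemma F_polar_scale: "real_polynomial_function f \<Longrightarrow> F_polar (\<lambda>y. c * f y) = c * F_polar f"
  unfolding F_polar_def by (subst F_restrict_scale[symmetric]) (auto simp: even_part_def field_simps intro!: F_restrict_cong)

lemma F_polar_sum:
  "finite I \<Longrightarrow> (\<And>i. i \<in> I \<Longrightarrow> real_polynomial_function (f i)) \<Longrightarrow> F_polar (\<lambda>y. \<Sum>i\<in>I. f i y) = (\<Sum>i\<in>I. F_polar (f i))"
  unfolding F_polar_def
  by (subst F_restrict_sum[symmetric])
    (auto simp: even_part_def sum.distrib sum_divide_distrib add_divide_distrib intro!: F_restrict_cong)

text \<open>In the even part of a square the cross terms cancel, leaving the squares of the even and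
  the odd part. The latter is split by the squared direction components into squares of elements of
  the algebra.\<close>

lemma F_polar_square:
  assumes g: "real_polynomial_function g"
  shows "0 \<le> F_polar (\<lambda>y. (g y)\<^sup>2)"
proof -
  let ?o = "\<lambda>l x. odd_part g x * (x $ l / norm x)"
  have e: "in_extended_algebra (even_part g)" and o: "in_extended_algebra (?o l)" for l
    using even_odd_part_in_extended_algebra[OF g] by auto
  have sq: "in_extended_algebra f \<Longrightarrow> in_extended_algebra (\<lambda>x. (f x)\<^sup>2)" for f :: "real ^ 'n \<Rightarrow> real"
    unfolding power2_eq_square by (rule in_extended_algebra_mult)
  have "F_polar (\<lambda>y. (g y)\<^sup>2) = F_restrict (\<lambda>x. (even_part g x)\<^sup>2 + (\<Sum>l\<in>UNIV. (?o l x)\<^sup>2))"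
    unfolding F_polar_def
  proof (rule F_restrict_cong)
    fix x :: "real ^ 'n" assume "x \<noteq> 0"
    have "(\<Sum>l\<in>UNIV. (?o l x)\<^sup>2) = (odd_part g x)\<^sup>2 * (\<Sum>l\<in>UNIV. (x $ l / norm x)\<^sup>2)"
      unfolding sum_distrib_left power_mult_distrib ..
    then have o2: "(\<Sum>l\<in>UNIV. (?o l x)\<^sup>2) = (odd_part g x)\<^sup>2"
      by (simp only: sum_direction_squares[OF \<open>x \<noteq> 0\<close>] mult_1_right)
    show "even_part (\<lambda>y. (g y)\<^sup>2) x = (even_part g x)\<^sup>2 + (\<Sum>l\<in>UNIV. (?o l x)\<^sup>2)"
      unfolding o2 by (simp add: even_part_def odd_part_def field_simps power2_eq_square)
  qed
  also have "\<dots> = F_restrict (\<lambda>x. (even_part g x)\<^sup>2) + F_restrict (\<lambda>x. \<Sum>l\<in>UNIV. (?o l x)\<^sup>2)"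
    by (intro F_restrict_add sq e o in_extended_algebra_sum finite)
  also have "F_restrict (\<lambda>x. \<Sum>l\<in>UNIV. (?o l x)\<^sup>2) = (\<Sum>l\<in>UNIV. F_restrict (\<lambda>x. (?o l x)\<^sup>2))"
    by (intro F_restrict_sum sq o finite)
  also have "F_restrict (\<lambda>x. (even_part g x)\<^sup>2) + \<dots> \<ge> 0" by (intro add_nonneg_nonneg sum_nonneg F_restrict_square e o)
  finally show ?thesis .
qed

section \<open>Multipliers that preserve positivity\<close>

definition localizing :: "(real \<times> (real ^ 'n) \<Rightarrow> real) \<Rightarrow> bool" where
  "localizing t \<longleftrightarrow> real_polynomial_function t \<and>
     (\<forall>h. real_polynomial_function h \<longrightarrow> 0 \<le> F_polar (\<lambda>y. t y * (h y)\<^sup>2))"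

text \<open>Quantifying over all weights \<open>t\<close> makes closure under products immediate, so
  each kind of factor can be treated on its own.\<close>

definition localizing_factor :: "(real \<times> (real ^ 'n) \<Rightarrow> real) \<Rightarrow> bool" where
  "localizing_factor f \<longleftrightarrow> (\<forall>t. localizing t \<longrightarrow> localizing (\<lambda>y. f y * t y))"

lemma localizing_factorI:
  assumes "real_polynomial_function f"
    "\<And>t h. localizing t \<Longrightarrow> real_polynomial_function t \<Longrightarrow> real_polynomial_function h \<Longrightarrow> 0 \<le> F_polar (\<lambda>y. f y * t y * (h y)\<^sup>2)"
  shows "localizing_factor f"
  using assms unfolding localizing_factor_def localizing_def by blast

lemma localizingD:
  "localizing t \<Longrightarrow> real_polynomial_function h \<Longrightarrow> 0 \<le> F_polar (\<lambda>y. t y * (h y)\<^sup>2)"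
  by (simp add: localizing_def)

lemma localizing_factor_nonneg: "localizing_factor f \<Longrightarrow> 0 \<le> F_polar f"
proof -
  have "localizing (\<lambda>y. 1)" unfolding localizing_def using F_polar_square by auto
  moreover assume "localizing_factor f"
  ultimately have "localizing (\<lambda>y. f y * 1)" unfolding localizing_factor_def by blast
  from localizingD[OF this, of "\<lambda>y. 1"] show ?thesis by auto
qed

lemma localizing_factor_mult:
  assumes "localizing_factor f" "localizing_factor g"
  shows "localizing_factor (\<lambda>y. f y * g y)"
  using assms unfolding localizing_factor_def mult.assoc by blast

lemma localizing_factor_const: "0 \<le> c \<Longrightarrow> localizing_factor (\<lambda>y. c)"
proof (rule localizing_factorI)
  fix t h :: "real \<times> (real ^ 'n) \<Rightarrow> real"
  assume c: "0 \<le> c" and t: "localizing t" and rt: "real_polynomial_function t" and rh: "real_polynomial_function h"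
  have "F_polar (\<lambda>y. c * (t y * (h y)\<^sup>2)) = c * F_polar (\<lambda>y. t y * (h y)\<^sup>2)"
    by (intro F_polar_scale real_polynomial_function_polar_intros rt rh)
  then show "0 \<le> F_polar (\<lambda>y. c * t y * (h y)\<^sup>2)"
    using c localizingD[OF t rh] by (simp add: mult.assoc)
qed auto

lemma localizing_factor_power: "localizing_factor f \<Longrightarrow> localizing_factor (\<lambda>y. f y ^ n)"
  by (induction n) (auto simp: localizing_factor_const localizing_factor_mult)

lemma localizing_factor_prod:
  "finite I \<Longrightarrow> (\<And>i. i \<in> I \<Longrightarrow> localizing_factor (f i)) \<Longrightarrow> localizing_factor (\<lambda>y. \<Prod>i\<in>I. f i y)"
  by (induction I rule: finite_induct) (auto simp: localizing_factor_const localizing_factor_mult)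

text \<open>On the unit sphere \<open>2 (1 + \<sigma> s\<^sub>k) = (1 + \<sigma> s\<^sub>k)\<^sup>2 + (\<Sum>l\<noteq>k. s\<^sub>l\<^sup>2)\<close> if \<open>\<sigma> = \<plusminus>1\<close>.\<close>

lemma localizing_factor_one_plus:
  fixes \<sigma> :: real
  assumes \<sigma>: "\<sigma>\<^sup>2 = 1"
  shows "localizing_factor (\<lambda>y. 1 + \<sigma> * snd y $ k)"
proof (rule localizing_factorI)
  fix t h :: "real \<times> (real ^ 'n) \<Rightarrow> real"
  assume t: "localizing t" and rt: "real_polynomial_function t" and rh: "real_polynomial_function h"
  let ?a = "\<lambda>y :: real \<times> (real ^ 'n). (1 + \<sigma> * snd y $ k) * h y" and ?b = "\<lambda>l (y :: real \<times> (real ^ 'n)). snd y $ l * h y"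
  have ra: "real_polynomial_function ?a" and rb: "real_polynomial_function (?b l)" for l
    by (intro real_polynomial_function_polar_intros rh)+
  have "F_polar (\<lambda>y. (1 + \<sigma> * snd y $ k) * t y * (h y)\<^sup>2) =
      F_polar (\<lambda>y. 1/2 * (t y * (?a y)\<^sup>2 + (\<Sum>l\<in>UNIV - {k}. t y * (?b l y)\<^sup>2)))"
  proof (rule F_polar_cong)
    fix r and s :: "real ^ 'n" assume "norm s = 1"
    then have "1 = (\<Sum>l\<in>UNIV. (s $ l)\<^sup>2)" using norm_square_cart[of s] by simp
    also have "\<dots> = (s $ k)\<^sup>2 + (\<Sum>l\<in>UNIV - {k}. (s $ l)\<^sup>2)" by (subst sum.remove[of _ k]) auto
    finally have s: "(\<Sum>l\<in>UNIV - {k}. (s $ l)\<^sup>2) = 1 - (s $ k)\<^sup>2" by simp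
    have "(\<Sum>l\<in>UNIV - {k}. t (r, s) * (s $ l * h (r, s))\<^sup>2) = t (r, s) * (h (r, s))\<^sup>2 * (\<Sum>l\<in>UNIV - {k}. (s $ l)\<^sup>2)"
      unfolding sum_distrib_left by (intro sum.cong) (auto simp: power_mult_distrib)
    then have b: "(\<Sum>l\<in>UNIV - {k}. t (r, s) * (s $ l * h (r, s))\<^sup>2) = t (r, s) * (h (r, s))\<^sup>2 * (1 - (s $ k)\<^sup>2)"
      unfolding s .
    have "t (r, s) * ((1 + \<sigma> * s $ k) * h (r, s))\<^sup>2 + t (r, s) * (h (r, s))\<^sup>2 * (1 - (s $ k)\<^sup>2) =
       t (r, s) * (h (r, s))\<^sup>2 * ((1 + \<sigma> * s $ k)\<^sup>2 + (1 - (s $ k)\<^sup>2))"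
      by (simp add: algebra_simps power2_eq_square)
    also have "(1 + \<sigma> * s $ k)\<^sup>2 + (1 - (s $ k)\<^sup>2) = 2 * (1 + \<sigma> * s $ k)"
      using \<sigma> by (simp add: power2_sum power_mult_distrib)
    finally show "(1 + \<sigma> * snd (r, s) $ k) * t (r, s) * (h (r, s))\<^sup>2 =
      1/2 * (t (r, s) * (?a (r, s))\<^sup>2 + (\<Sum>l\<in>UNIV - {k}. t (r, s) * (?b l (r, s))\<^sup>2))"
      unfolding snd_conv b by simp
  qed
  also have "\<dots> = 1/2 * (F_polar (\<lambda>y. t y * (?a y)\<^sup>2) + (\<Sum>l\<in>UNIV - {k}. F_polar (\<lambda>y. t y * (?b l y)\<^sup>2)))"
    by (subst F_polar_scale, (intro real_polynomial_function_polar_intros rt ra rb; simp),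
        subst F_polar_add, (intro real_polynomial_function_polar_intros rt ra rb; simp)+,
        subst F_polar_sum, simp, (intro real_polynomial_function_polar_intros rt rb), simp)
  also have "\<dots> \<ge> 0"
    by (intro mult_nonneg_nonneg add_nonneg_nonneg sum_nonneg localizingD[OF t] ra rb) auto
  finally show "0 \<le> F_polar (\<lambda>y. (1 + \<sigma> * snd y $ k) * t y * (h y)\<^sup>2)" .
qed (intro real_polynomial_function_polar_intros)

lemma localizing_factor_nonneg_poly:
  assumes "\<And>r. 0 \<le> poly q r"
  shows "localizing_factor (\<lambda>y. poly q (fst y))"
  using assms
proof (induction rule: nonneg_poly_induct)
  case (const c)
  then show ?case by (simp add: localizing_factor_const)
next
  case (step m a q)
  show ?case
  proof (rule localizing_factorI)
    fix t h :: "real \<times> (real ^ 'n) \<Rightarrow> real"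
    assume t: "localizing t" and rt: "real_polynomial_function t" and rh: "real_polynomial_function h"
    \<comment> \<open>The squared linear factor is absorbed into the test square, which leaves the
      weight \<open>q\<close> of the induction hypothesis.\<close>
    let ?h = "\<lambda>y :: real \<times> (real ^ 'n). (fst y - a) * h y"
    have rh': "real_polynomial_function ?h" by (intro real_polynomial_function_polar_intros rh)
    have "localizing (\<lambda>y. poly q (fst y) * t y)" using step t by (simp add: localizing_factor_def)
    from localizingD[OF this rh'] localizingD[OF t rh]
    have "0 \<le> m * F_polar (\<lambda>y. t y * (h y)\<^sup>2) + F_polar (\<lambda>y. poly q (fst y) * t y * (?h y)\<^sup>2)"
      using step by simp
    also have "\<dots> = F_polar (\<lambda>y. m * (t y * (h y)\<^sup>2) + poly q (fst y) * t y * (?h y)\<^sup>2)"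
      by (subst F_polar_scale[symmetric], (intro real_polynomial_function_polar_intros rt rh),
        subst F_polar_add[symmetric], (intro real_polynomial_function_polar_intros rt rh)+, simp)
    also have "\<dots> = F_polar (\<lambda>y. poly ([:m:] + [:-a, 1:]\<^sup>2 * q) (fst y) * t y * (h y)\<^sup>2)"
      by (intro F_polar_cong) (simp add: power2_eq_square algebra_simps)
    finally show "0 \<le> F_polar (\<lambda>y. poly ([:m:] + [:-a, 1:]\<^sup>2 * q) (fst y) * t y * (h y)\<^sup>2)" .
  qed (intro real_polynomial_function_polar_intros)
qed

lemma localizing_factor_bernstein_weight: "localizing_factor (\<lambda>y. bernstein_weight n j (snd y $ k))"
proof -
  have "localizing_factor (\<lambda>y. 1/2 * (1 + 1 * snd y $ k))" "localizing_factor (\<lambda>y. 1/2 * (1 + - 1 * snd y $ k))"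
    by (intro localizing_factor_mult localizing_factor_const localizing_factor_one_plus; simp)+
  then have "localizing_factor (\<lambda>y. (1 + snd y $ k) / 2)" "localizing_factor (\<lambda>y. (1 - snd y $ k) / 2)"
    by simp_all
  then show ?thesis unfolding bernstein_weight_def
    by (intro localizing_factor_mult localizing_factor_const localizing_factor_power) auto
qed

text \<open>Each summand is a nonnegative univariate polynomial in the radius times Bernstein
  weights of the direction components, hence a localizing factor.\<close>

lemma F_polar_bernstein_approx_nonneg:
  assumes f: "f \<in> polyfun" "\<And>x. 0 \<le> f x"
  shows "0 \<le> F_polar (bernstein_approx n f)"
proof -
  have "F_polar (bernstein_approx n f) = (\<Sum>j\<in>(\<Pi>\<^sub>E i\<in>UNIV. {..n}).
     F_polar (\<lambda>y. f (fst y *\<^sub>R (\<chi> i. bernstein_node n (j i))) * (\<Prod>i\<in>UNIV. bernstein_weight n (j i) (snd y $ i))))"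
    unfolding bernstein_approx_def[abs_def]
    by (intro F_polar_sum real_polynomial_function_bernstein_term f finite_PiE) auto
  also have "\<dots> \<ge> 0"
  proof (intro sum_nonneg localizing_factor_nonneg localizing_factor_mult localizing_factor_prod localizing_factor_bernstein_weight)
    fix j :: "'n \<Rightarrow> nat"
    obtain q where q: "\<And>r. f (r *\<^sub>R (\<chi> i. bernstein_node n (j i))) = poly q r"
      using polyfun_along_line[OF f(1)] by blast
    show "localizing_factor (\<lambda>y. f (fst y *\<^sub>R (\<chi> i. bernstein_node n (j i))))"
      unfolding q using f(2) by (intro localizing_factor_nonneg_poly) (simp flip: q)
  qed simp
  finally show ?thesis .
qed

text \<open>The index set depends on \<open>\<alpha>\<close> alone and the values of
  \<open>F_polar\<close> on the right do not involve \<open>q\<close>. A limit in \<open>q\<close>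
  is thereby reduced to limits of finitely many coefficients.\<close>

lemma F_polar_expand:
  fixes q :: "'n \<Rightarrow> real poly"
  assumes "\<And>i. degree (q i) \<le> \<alpha> i"
  shows "F_polar (\<lambda>y. c * fst y ^ k * (\<Prod>i\<in>UNIV. poly (q i) (snd y $ i))) =
    (\<Sum>\<gamma>\<in>(\<Pi>\<^sub>E i\<in>UNIV. {..\<alpha> i}). (\<Prod>i\<in>UNIV. coeff (q i) (\<gamma> i)) *
       F_polar (\<lambda>y. c * fst y ^ k * (\<Prod>i\<in>UNIV. (snd y $ i) ^ \<gamma> i)))"
proof -
  have "(\<lambda>y :: real \<times> (real ^ 'n). c * fst y ^ k * (\<Prod>i\<in>UNIV. poly (q i) (snd y $ i))) =
    (\<lambda>y. \<Sum>\<gamma>\<in>(\<Pi>\<^sub>E i\<in>UNIV. {..\<alpha> i}). (\<Prod>i\<in>UNIV. coeff (q i) (\<gamma> i)) *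
      (c * fst y ^ k * (\<Prod>i\<in>UNIV. (snd y $ i) ^ \<gamma> i)))"
    unfolding poly_eq_sum_coeff[OF assms]
    by (subst prod_sum_PiE) (auto simp: sum_distrib_left prod.distrib mult_ac)
  then show ?thesis
    by (simp only:) (subst F_polar_sum, auto intro!: finite_PiE sum.cong F_polar_scale real_polynomial_function_polar_intros)
qed

lemma F_polar_bernstein_approx_tendsto:
  assumes "f \<in> polyfun"
  shows "(\<lambda>n. F_polar (bernstein_approx n f)) \<longlonglongrightarrow> F_polar (\<lambda>y. f (fst y *\<^sub>R snd y))"
  using assms
proof (induction rule: polyfun.induct)
  case (monom c \<alpha>)
  let ?k = "\<Sum>i\<in>UNIV. \<alpha> i"
  have "(\<lambda>n. F_polar (\<lambda>y. c * fst y ^ ?k * (\<Prod>i\<in>UNIV. poly (bernstein_monom n (\<alpha> i)) (snd y $ i))))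
     \<longlonglongrightarrow> F_polar (\<lambda>y. c * fst y ^ ?k * (\<Prod>i\<in>UNIV. poly (Polynomial.monom 1 (\<alpha> i)) (snd y $ i)))"
    by (subst (1 2) F_polar_expand[where \<alpha> = \<alpha>])
      (intro tendsto_sum tendsto_mult tendsto_prod tendsto_const coeff_bernstein_monom_tendsto
        degree_bernstein_monom degree_monom_le)+
  \<comment> \<open>The product formula \<open>bernstein_approx_monom\<close> needs
    \<open>n > 0\<close>, so the sequences are compared from 1 on.\<close>
  then have "(\<lambda>n. F_polar (bernstein_approx n (\<lambda>x. c * (\<Prod>i\<in>UNIV. (x $ i) ^ \<alpha> i))))
     \<longlonglongrightarrow> F_polar (\<lambda>y. c * fst y ^ ?k * (\<Prod>i\<in>UNIV. poly (Polynomial.monom 1 (\<alpha> i)) (snd y $ i)))"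
    by (rule Lim_transform_eventually)
      (auto simp: bernstein_approx_monom intro!: eventually_sequentiallyI[of 1])
  then show ?case by (simp add: poly_monom power_mult_distrib prod.distrib power_sum mult.assoc)
next
  case (add f g)
  have "bernstein_approx n (\<lambda>x. f x + g x) = (\<lambda>y. bernstein_approx n f y + bernstein_approx n g y)" for n
    by (auto simp: bernstein_approx_def sum.distrib algebra_simps)
  then show ?case
    using add by (simp add: F_polar_add real_polynomial_function_bernstein_approx polyfun_polar) (intro tendsto_intros)
qed

text \<open>The product of radius and direction is \<open>x\<close> at both \<open>polar x\<close>
  and \<open>- polar x\<close>, so the even part of the limit function is \<open>f\<close> away from
  the origin.\<close>

lemma F_restrict_nonneg:
  assumes f: "f \<in> polyfun" "\<And>x. 0 \<le> f x"
  shows "0 \<le> F_restrict f"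
proof -
  have "0 \<le> F_polar (\<lambda>y. f (fst y *\<^sub>R snd y))"
    using F_polar_bernstein_approx_nonneg[OF f]
    by (intro tendsto_lowerbound[OF F_polar_bernstein_approx_tendsto[OF f(1)]]) auto
  also have "\<dots> = F_restrict f"
    unfolding F_polar_def by (intro F_restrict_cong) (simp add: even_part_def polar_def)
  finally show ?thesis .
qed

end

section \<open>The moment functional criterion\<close>

context positive_extension
begin

text \<open>Haviland's theorem is applied after division by the total mass \<open>c\<close>. If
  \<open>c = 0\<close>, positivity on squares forces the functional to vanish on all
  polynomials.\<close>

lemma moment_functional_restriction:
  assumes L: "\<And>p. F (restrict (poly_eval p) punctured_space) = L p"
  shows "moment_functional L"
proof -
  note in_poly = in_extended_algebra_polyfun
  define c where "c = F_restrict (\<lambda>x. 1)"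
  have c0: "0 \<le> c" unfolding c_def by (intro F_restrict_nonneg polyfun_const) simp
  have zero: "F_restrict f = 0" if "c = 0" and f: "f \<in> polyfun" for f
  proof (rule ccontr)
    assume nz: "F_restrict f \<noteq> 0"
    \<comment> \<open>With \<open>c = 0\<close> the value on the square of \<open>f + a\<close> is
      affine in \<open>a\<close>; this choice makes it -1.\<close>
    define a where "a = - (F_restrict (\<lambda>x. (f x)\<^sup>2) + 1) / (2 * F_restrict f)"
    have f2: "(\<lambda>x. (f x)\<^sup>2) \<in> polyfun" using polyfun_mult[OF f f] by (simp add: power2_eq_square)
    have "0 \<le> F_restrict (\<lambda>x. (f x + a)\<^sup>2)"
      by (intro F_restrict_square in_extended_algebra_add in_extended_algebra_const in_poly f)
    also have "\<dots> = F_restrict (\<lambda>x. (f x)\<^sup>2 + ((2 * a) * f x + a\<^sup>2 * 1))"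
      by (intro F_restrict_cong) (simp add: power2_eq_square algebra_simps)
    also have "\<dots> = F_restrict (\<lambda>x. (f x)\<^sup>2) + (2 * a * F_restrict f + a\<^sup>2 * c)"
      unfolding c_def
      by (subst F_restrict_add F_restrict_scale | intro in_extended_algebra_add in_extended_algebra_mult in_extended_algebra_const in_poly f f2 | simp only:)+
    also have "\<dots> = - 1" using nz \<open>c = 0\<close> by (simp add: a_def field_simps)
    finally show False by simp
  qed
  \<comment> \<open>For \<open>c = 0\<close> any state will do, since the measure is rescaled by \<open>c\<close> in the end.\<close>
  define \<Lambda> where "\<Lambda> f = (if c = 0 then f 0 else F_restrict f / c)" for f :: "real ^ 'n \<Rightarrow> real"
  have F_restrict_eq: "F_restrict f = c * \<Lambda> f" if "f \<in> polyfun" for f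
    using zero[OF _ that] by (simp add: \<Lambda>_def)
  have "state_on_functions polyfun \<Lambda>"
  proof
    show "\<Lambda> (\<lambda>x. f x + g x) = \<Lambda> f + \<Lambda> g" if "f \<in> polyfun" "g \<in> polyfun" for f g
      using that by (simp add: \<Lambda>_def F_restrict_add in_poly add_divide_distrib)
    show "\<Lambda> (\<lambda>x. a * f x) = a * \<Lambda> f" if "f \<in> polyfun" for f a
      using that by (simp add: \<Lambda>_def F_restrict_scale in_poly)
    show "0 \<le> \<Lambda> f" if "f \<in> polyfun" "\<And>x. 0 \<le> f x" for f
      using that c0 by (simp add: \<Lambda>_def F_restrict_nonneg)
    show "\<Lambda> (\<lambda>x. 1) = 1" by (simp add: \<Lambda>_def c_def)
  qed (auto intro: polyfun_const polyfun.add polyfun_mult)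
  then obtain M where M: "prob_space M" "sets M = sets (borel :: (real ^ 'n) measure)"
    "\<And>f. f \<in> polyfun \<Longrightarrow> integrable M f \<and> (\<integral>x. f x \<partial>M) = \<Lambda> f"
    by (rule haviland_prob) blast
  let ?M = "density M (\<lambda>_. ennreal c)"
  have "integrable ?M (poly_eval p) \<and> L p = (\<integral>x. poly_eval p x \<partial>?M)" for p
  proof -
    have p: "poly_eval p \<in> polyfun" using range_poly_eval by blast
    have "poly_eval p \<in> borel_measurable M"
      using borel_measurable_continuous_onI[OF continuous_on_polyfun[OF p]] measurable_cong_sets[OF M(2) refl] by blast
    then show ?thesis
      using M(3)[OF p] F_restrict_eq[OF p] c0 L[of p]
      by (simp add: integrable_density integral_density F_restrict_def)
  qed
  then show ?thesis unfolding moment_functional_def using M(2) by (intro exI[of _ ?M]) auto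
qed

end

section \<open>Extending the algebra to the origin\<close>

text \<open>A limit is taken because limits respect sums and products, so that squares extend to
  squares even at an atom in the origin.\<close>

definition ray_extension :: "real ^ 'n::finite \<Rightarrow> (real ^ 'n \<Rightarrow> real) \<Rightarrow> real ^ 'n \<Rightarrow> real" where
  "ray_extension e f x = (if x = 0 then Lim (at_right 0) (\<lambda>t. f (t *\<^sub>R e)) else f x)"

lemma ray_extension_restrict:
  assumes "e \<noteq> 0" and lim: "((\<lambda>t. f (t *\<^sub>R e)) \<longlongrightarrow> l) (at_right 0)"
  shows "((\<lambda>t. restrict f punctured_space (t *\<^sub>R e)) \<longlongrightarrow> l) (at_right 0)"
    and "ray_extension e (restrict f punctured_space) = (\<lambda>x. if x = 0 then l else f x)"
proof -
  show *: "((\<lambda>t. restrict f punctured_space (t *\<^sub>R e)) \<longlongrightarrow> l) (at_right 0)"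
  proof (rule Lim_transform_eventually[OF lim])
    show "\<forall>\<^sub>F t in at_right 0. f (t *\<^sub>R e) = restrict f punctured_space (t *\<^sub>R e)"
      using eventually_at_right_less[of 0]
      by eventually_elim (use \<open>e \<noteq> 0\<close> in \<open>simp add: punctured_space_def\<close>)
  qed
  show "ray_extension e (restrict f punctured_space) = (\<lambda>x. if x = 0 then l else f x)"
    using tendsto_Lim[OF _ *] by (auto simp: ray_extension_def punctured_space_def fun_eq_iff)
qed

text \<open>Polynomials are continuous, while the functions \<open>sphere_fun k l\<close> are
  constant along rays and bounded by 1. The polynomial majorant will give integrability.\<close>

lemma ray_extension_extended_algebra:
  assumes e: "e \<noteq> 0" and f: "f \<in> extended_algebra"
  shows "((\<lambda>t. f (t *\<^sub>R e)) \<longlongrightarrow> ray_extension e f 0) (at_right 0) \<and>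
    ray_extension e f \<in> borel_measurable borel \<and>
    (\<exists>w\<in>polyfun. \<forall>x. \<bar>ray_extension e f x\<bar> \<le> w x)"
  using f unfolding extended_algebra_def
proof (induction rule: generated_algebra.induct)
  case (gen g)
  then consider "g \<in> polyfun" | k l where "g = sphere_fun k l" using range_poly_eval by auto
  then show ?case
  proof cases
    case 1
    have "((\<lambda>t. g (t *\<^sub>R e)) \<longlongrightarrow> g (0 *\<^sub>R e)) (at_right 0)"
      using continuous_on_polyfun[OF 1, of UNIV]
      by (intro isCont_tendsto_compose[of _ g] tendsto_intros) (auto simp: continuous_on_eq_continuous_at)
    then have "((\<lambda>t. g (t *\<^sub>R e)) \<longlongrightarrow> g 0) (at_right 0)" by simp
    note * = ray_extension_restrict[OF e this]
    have eq: "ray_extension e (restrict g punctured_space) = g" unfolding *(2) by auto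
    have "g \<in> borel_measurable borel"
      using continuous_on_polyfun[OF 1] by (rule borel_measurable_continuous_onI)
    \<comment> \<open>The absolute value of \<open>g\<close> need not be polynomial, but this
      majorant is.\<close>
    moreover have "(\<lambda>x. 1 + g x * g x) \<in> polyfun" by (intro polyfun.add polyfun_const polyfun_mult 1)
    moreover have "\<bar>g x\<bar> \<le> 1 + g x * g x" for x
      using sum_squares_bound[of "\<bar>g x\<bar>" 1] by (simp add: power2_eq_square)
    ultimately show ?thesis unfolding eq using *(1) by (intro conjI bexI[of _ "\<lambda>x. 1 + g x * g x"] allI)
  next
    case 2
    have "((\<lambda>t. g (t *\<^sub>R e)) \<longlongrightarrow> g e) (at_right 0)"
    proof (rule Lim_transform_eventually[OF tendsto_const])
      show "\<forall>\<^sub>F t in at_right 0. g e = g (t *\<^sub>R e)"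
        using eventually_at_right_less[of 0]
        by eventually_elim
          (use e in \<open>simp only: 2 sphere_fun_def norm_square_cart[symmetric]; simp add: power_mult_distrib power2_eq_square field_simps\<close>)
    qed
    note * = ray_extension_restrict[OF e this]
    have [measurable]: "(\<lambda>x :: real ^ 'a. x $ i) \<in> borel_measurable borel" for i
      by (intro borel_measurable_continuous_onI continuous_intros)
    have r0: "ray_extension e (restrict g punctured_space) 0 = g e" unfolding *(2) by simp
    have "g \<in> borel_measurable borel" unfolding 2 sphere_fun_def[abs_def] by measurable
    then have "ray_extension e (restrict g punctured_space) \<in> borel_measurable borel" unfolding *(2) by measurable
    moreover have "\<bar>g x\<bar> \<le> 1" for x
    proof (cases "x = 0")
      case False
      have "\<bar>x $ k\<bar> * \<bar>x $ l\<bar> \<le> norm x * norm x" by (intro mult_mono component_le_norm_cart) auto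
      then show ?thesis using False
        by (simp only: 2 sphere_fun_def norm_square_cart[symmetric]) (simp add: abs_mult power2_eq_square field_simps)
    qed (simp add: 2 sphere_fun_def)
    then have "\<forall>x. \<bar>ray_extension e (restrict g punctured_space) x\<bar> \<le> 1" unfolding *(2) by auto
    ultimately show ?thesis unfolding r0 using *(1) polyfun_const[of 1]
      by (intro conjI bexI[of _ "\<lambda>x. 1"])
  qed
next
  case (const c)
  have "((\<lambda>t. (\<lambda>x :: real ^ 'a. c) (t *\<^sub>R e)) \<longlongrightarrow> c) (at_right 0)" by simp
  note * = ray_extension_restrict[OF e this]
  have eq: "ray_extension e (\<lambda>x\<in>punctured_space. c) = (\<lambda>x. c)" unfolding *(2) by auto
  show ?case unfolding eq using *(1) polyfun_const[of "\<bar>c\<bar>"] by auto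
next
  case (add f g)
  then have "((\<lambda>t. f (t *\<^sub>R e) + g (t *\<^sub>R e)) \<longlongrightarrow> ray_extension e f 0 + ray_extension e g 0) (at_right 0)"
    by (intro tendsto_intros) auto
  note * = ray_extension_restrict[OF e this]
  have eq: "ray_extension e (\<lambda>x\<in>punctured_space. f x + g x) = (\<lambda>x. ray_extension e f x + ray_extension e g x)"
    unfolding *(2) by (auto simp: ray_extension_def)
  obtain v w where "v \<in> polyfun" "w \<in> polyfun" "\<And>x. \<bar>ray_extension e f x\<bar> \<le> v x" "\<And>x. \<bar>ray_extension e g x\<bar> \<le> w x"
    using add.IH by blast
  then have "\<exists>w\<in>polyfun. \<forall>x. \<bar>ray_extension e f x + ray_extension e g x\<bar> \<le> w x"
    by (intro bexI[of _ "\<lambda>x. v x + w x"] polyfun.add) (auto intro: order.trans[OF abs_triangle_ineq] add_mono)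
  then show ?case using *(1) add.IH unfolding eq by auto
next
  case (mult f g)
  then have "((\<lambda>t. f (t *\<^sub>R e) * g (t *\<^sub>R e)) \<longlongrightarrow> ray_extension e f 0 * ray_extension e g 0) (at_right 0)"
    by (intro tendsto_intros) auto
  note * = ray_extension_restrict[OF e this]
  have eq: "ray_extension e (\<lambda>x\<in>punctured_space. f x * g x) = (\<lambda>x. ray_extension e f x * ray_extension e g x)"
    unfolding *(2) by (auto simp: ray_extension_def)
  obtain v w where vw: "v \<in> polyfun" "w \<in> polyfun" "\<And>x. \<bar>ray_extension e f x\<bar> \<le> v x" "\<And>x. \<bar>ray_extension e g x\<bar> \<le> w x"
    using mult.IH by blast
  then have "\<exists>w\<in>polyfun. \<forall>x. \<bar>ray_extension e f x * ray_extension e g x\<bar> \<le> w x"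
    by (intro bexI[of _ "\<lambda>x. v x * w x"] polyfun_mult)
      (auto simp: abs_mult intro!: mult_mono order.trans[OF abs_ge_zero vw(3)])
  then show ?case using *(1) mult.IH unfolding eq by auto
qed

text \<open>The ray extension returns each polynomial on all of space, origin included, so
  integrating it recovers \<open>L\<close> exactly.\<close>

lemma moment_functional_extends:
  fixes L :: "'n::finite polynomial \<Rightarrow> real"
  assumes "moment_functional L"
  obtains F where "linear_functional_on punctured_space extended_algebra F"
    "positive_functional_on punctured_space extended_algebra F"
    "\<And>p. F (restrict (poly_eval p) punctured_space) = L p"
proof -
  obtain M :: "(real ^ 'n) measure" where M: "sets M = sets borel"
    "\<And>p. integrable M (poly_eval p)" "\<And>p. L p = (\<integral>x. poly_eval p x \<partial>M)"
    using assms unfolding moment_functional_def by blast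
  \<comment> \<open>Any nonzero vector would do; \<open>undefined\<close> merely names some
    index.\<close>
  define e :: "real ^ 'n" where "e = axis undefined 1"
  have e: "e \<noteq> 0" by (simp add: e_def axis_eq_0_iff)
  let ?X = "punctured_space :: (real ^ 'n) set"
  define F where "F f = (\<integral>x. ray_extension e f x \<partial>M)" for f
  note R = ray_extension_extended_algebra[OF e]
  have int: "integrable M (ray_extension e f)" if f: "f \<in> extended_algebra" for f
  proof -
    obtain w where w: "w \<in> polyfun" "\<And>x. \<bar>ray_extension e f x\<bar> \<le> w x" using R[OF f] by blast
    have "integrable M w" using w(1) M(2) range_poly_eval by (metis rangeE)
    moreover have "ray_extension e f \<in> borel_measurable M"
      using R[OF f] measurable_cong_sets[OF M(1) refl] by blast
    ultimately show ?thesis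
      by (rule Bochner_Integration.integrable_bound) (auto intro!: AE_I2 order.trans[OF w(2)])
  qed
  have add: "ray_extension e (\<lambda>x\<in>?X. f x + g x) = (\<lambda>x. ray_extension e f x + ray_extension e g x)"
    if "f \<in> extended_algebra" "g \<in> extended_algebra" for f g
    using R that by (subst ray_extension_restrict(2)[OF e tendsto_add]) (auto simp: ray_extension_def)
  have scale: "ray_extension e (\<lambda>x\<in>?X. c * f x) = (\<lambda>x. c * ray_extension e f x)"
    if "f \<in> extended_algebra" for f c
    using R that by (subst ray_extension_restrict(2)[OF e tendsto_mult_left]) (auto simp: ray_extension_def)
  have square: "ray_extension e (\<lambda>x\<in>?X. (f x)\<^sup>2) = (\<lambda>x. (ray_extension e f x)\<^sup>2)"
    if "f \<in> extended_algebra" for f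
    using R that by (subst ray_extension_restrict(2)[OF e tendsto_power]) (auto simp: ray_extension_def)
  have poly: "ray_extension e (restrict (poly_eval p) ?X) = poly_eval p" for p
  proof -
    have "continuous_on UNIV (poly_eval p)" using range_poly_eval continuous_on_polyfun by blast
    then have "((\<lambda>t. poly_eval p (t *\<^sub>R e)) \<longlongrightarrow> poly_eval p (0 *\<^sub>R e)) (at_right 0)"
      by (intro isCont_tendsto_compose[of _ "poly_eval p"] tendsto_intros) (auto simp: continuous_on_eq_continuous_at)
    from ray_extension_restrict(2)[OF e this] show ?thesis by auto
  qed
  show ?thesis
  proof (rule that[of F])
    show "linear_functional_on ?X extended_algebra F"
      unfolding linear_functional_on_def F_def by (auto simp: add scale int)
    show "positive_functional_on ?X extended_algebra F"
      unfolding positive_functional_on_def F_def by (auto simp: square intro!: integral_nonneg)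
    show "F (restrict (poly_eval p) ?X) = L p" for p
      unfolding F_def poly M(3) ..
  qed
qed

theorem theorem7:
  fixes L :: "'n::finite polynomial \<Rightarrow> real"
  assumes "linear_functional L"
  shows "moment_functional L \<longleftrightarrow>
    (\<exists>F :: (real ^ 'n \<Rightarrow> real) \<Rightarrow> real.
       linear_functional_on punctured_space extended_algebra F \<and>
       positive_functional_on punctured_space extended_algebra F \<and>
       (\<forall>p. F (restrict (poly_eval p) punctured_space) = L p))"
proof
  assume "moment_functional L"
  then show "\<exists>F :: (real ^ 'n \<Rightarrow> real) \<Rightarrow> real.
       linear_functional_on punctured_space extended_algebra F \<and>
       positive_functional_on punctured_space extended_algebra F \<and>
       (\<forall>p. F (restrict (poly_eval p) punctured_space) = L p)"
    by (metis moment_functional_extends)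
next
  assume "\<exists>F :: (real ^ 'n \<Rightarrow> real) \<Rightarrow> real.
       linear_functional_on punctured_space extended_algebra F \<and>
       positive_functional_on punctured_space extended_algebra F \<and>
       (\<forall>p. F (restrict (poly_eval p) punctured_space) = L p)"
  then show "moment_functional L"
    using positive_extension.moment_functional_restriction positive_extension.intro by blast
qed

end
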